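(* Let $X$ be singular, let $i:Z=\mathrm{Sing}(X)\hookrightarrow X$ and $j:U=X_{\mathrm{reg}}\hookrightarrow X$ be the singular locus and its regular open complement (satisfying the recollement axioms), and let $C$ be a characteristic theory with values in $A\in\mathcal C(X)$ providing classes $C(X)$ and $C^{\mathrm{vir}}(X)$ with $j^*C^{\mathrm{vir}}(X)=j^*C(X)$. Let $G^C_Z(X)=\mathrm{im}\bigl(\delta:H^{*-1}(U;j^*A)\to H^*_Z(X;A)\bigr)$. If $G^C_Z(X)=0$, then the Milnor defect $\Delta_C(X)$ has a canonical supported refinement on $Z$; equivalently, the corresponding local Milnor class is formally unique (the set $\mathfrak{Mil}^C_Z(X)$ has exactly one element). Conversely, when $G^C_Z(X)\neq0$, the localisation triangle alone does not determine a distinguished local Milnor class: $\mathfrak{Mil}^C_Z(X)$ has more than one element, so any canonical choice must come from additional structure.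
   Context: Setting: to each space $X$ is attached a stable triangulated category $\mathcal C(X)$ with a symmetric monoidal structure $(\otimes,\mathbf 1_X)$. Each morphism $f$ has exact functors $f^*\dashv f_*$ with $f^*$ symmetric monoidal. Recollement axioms for a closed immersion $i:Z\hookrightarrow X$ with open complement $j:U\hookrightarrow X$: adjunctions $i^*\dashv i_*\dashv i^!$, $j_!\dashv j^*\dashv j_*$; $i_*,j_!$ fully faithful; $j^*i_*=0$, $i^*j_!=0$; functorial distinguished triangles $j_!j^*M\to M\to i_*i^*M\xrightarrow{+1}$, $i_*i^!M\to M\to j_*j^*M\xrightarrow{+1}$. Notation: $H^d(X;A)=\mathrm{Hom}(\mathbf 1_X,A[d])$; $H^d_Z(X;A)=\mathrm{Hom}(\mathbf 1_X,i_*i^!A[d])$; $\mathrm{forg}:H_Z^d(X;A)\to H^d(X;A)$ is induced by the counit $i_*i^!A\to A$. The localisation long exact sequence is $\cdots\to H_Z^d(X;A)\xrightarrow{\mathrm{forg}}H^d(X;A)\xrightarrow{j^*}H^d(U;j^*A)\xrightarrow{\delta}H_Z^{d+1}(X;A)\to\cdots$. An asterisk denotes the relevant (graded) degrees. Characteristic theory $C$ with values in a coefficient object $A$: it provides a functorial class $C(X)\in H^*(X;A)$ and a virtual, expected, or Fulton-type class $C^{\mathrm{vir}}(X)\in H^*(X;A)$; only these two classes and their agreement on $U$ are used. The Milnor defect is $\Delta_C(X)=C^{\mathrm{vir}}(X)-C(X)$, so $j^*\Delta_C(X)=0$. The Milnor localisation torsor, whose elements are the supported (Milnor) refinements of $\Delta_C(X)$,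 is $$\mathfrak{Mil}^C_Z(X)=\{\widetilde\Delta\in H^*_Z(X;A)\mid\mathrm{forg}(\widetilde\Delta)=\Delta_C(X)\}.$$ *)

theory Defs
  imports "HOL-Analysis.Abstract_Topology" "HOL-Algebra.Product_Groups"
begin

section \<open>Categories, functors, adjunctions\<close>

text \<open>Arrows carry their domain and codomain, so hom-sets between different pairs of objects
  are disjoint. Composition is written in the usual order: \<open>g \<cdot> f\<close> is ``first \<open>f\<close>, then \<open>g\<close>''.\<close>

record ('o, 'm) cat =
  Obj :: "'o set"
  Arr :: "'m set"
  Dom :: "'m \<Rightarrow> 'o"
  Cod :: "'m \<Rightarrow> 'o"
  Comp :: "'m \<Rightarrow> 'm \<Rightarrow> 'm" (infixr "\<cdot>\<index>" 75)
  Ident :: "'o \<Rightarrow> 'm"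

definition Hom :: "('o, 'm, 'z) cat_scheme \<Rightarrow> 'o \<Rightarrow> 'o \<Rightarrow> 'm set" where
  "Hom C a b = {f \<in> Arr C. Dom C f = a \<and> Cod C f = b}"

locale category =
  fixes C :: "('o, 'm, 'z) cat_scheme" (structure)
  assumes dom_obj: "f \<in> Arr C \<Longrightarrow> Dom C f \<in> Obj C"
    and cod_obj: "f \<in> Arr C \<Longrightarrow> Cod C f \<in> Obj C"
    and ident_hom: "a \<in> Obj C \<Longrightarrow> Ident C a \<in> Hom C a a"
    and comp_hom: "\<lbrakk>f \<in> Hom C a b; g \<in> Hom C b c\<rbrakk> \<Longrightarrow> g \<cdot> f \<in> Hom C a c"
    and comp_assoc: "\<lbrakk>f \<in> Hom C a b; g \<in> Hom C b c; h \<in> Hom C c d\<rbrakk>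
      \<Longrightarrow> (h \<cdot> g) \<cdot> f = h \<cdot> (g \<cdot> f)"
    and ident_left: "f \<in> Hom C a b \<Longrightarrow> Ident C b \<cdot> f = f"
    and ident_right: "f \<in> Hom C a b \<Longrightarrow> f \<cdot> Ident C a = f"

definition inverse_arrows :: "('o, 'm, 'z) cat_scheme \<Rightarrow> 'm \<Rightarrow> 'm \<Rightarrow> bool" where
  "inverse_arrows C f g \<longleftrightarrow> f \<in> Arr C \<and> g \<in> Hom C (Cod C f) (Dom C f) \<and>
     g \<cdot>\<^bsub>C\<^esub> f = Ident C (Dom C f) \<and> f \<cdot>\<^bsub>C\<^esub> g = Ident C (Cod C f)"

definition is_iso :: "('o, 'm, 'z) cat_scheme \<Rightarrow> 'm \<Rightarrow> bool" where
  "is_iso C f \<longleftrightarrow> (\<exists>g. inverse_arrows C f g)"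

definition inv_arr :: "('o, 'm, 'z) cat_scheme \<Rightarrow> 'm \<Rightarrow> 'm" where
  "inv_arr C f = (THE g. inverse_arrows C f g)"

definition is_zero_object :: "('o, 'm, 'z) cat_scheme \<Rightarrow> 'o \<Rightarrow> bool" where
  "is_zero_object C z \<longleftrightarrow> z \<in> Obj C \<and>
     (\<forall>a \<in> Obj C. (\<exists>!f. f \<in> Hom C a z) \<and> (\<exists>!f. f \<in> Hom C z a))"

record ('o, 'm) func =
  OMap :: "'o \<Rightarrow> 'o"
  AMap :: "'m \<Rightarrow> 'm"

definition is_functor ::
  "('o, 'm, 'z) cat_scheme \<Rightarrow> ('o, 'm, 'y) cat_scheme \<Rightarrow> ('o, 'm, 'x) func_scheme \<Rightarrow> bool" where
  "is_functor C D F \<longleftrightarrow>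
     (\<forall>a \<in> Obj C. OMap F a \<in> Obj D) \<and>
     (\<forall>a b. \<forall>f \<in> Hom C a b. AMap F f \<in> Hom D (OMap F a) (OMap F b)) \<and>
     (\<forall>a \<in> Obj C. AMap F (Ident C a) = Ident D (OMap F a)) \<and>
     (\<forall>a b c. \<forall>f \<in> Hom C a b. \<forall>g \<in> Hom C b c. AMap F (g \<cdot>\<^bsub>C\<^esub> f) = AMap F g \<cdot>\<^bsub>D\<^esub> AMap F f)"

definition fully_faithful ::
  "('o, 'm, 'z) cat_scheme \<Rightarrow> ('o, 'm, 'y) cat_scheme \<Rightarrow> ('o, 'm, 'x) func_scheme \<Rightarrow> bool" where
  "fully_faithful C D F \<longleftrightarrow>
     (\<forall>a \<in> Obj C. \<forall>b \<in> Obj C. bij_betw (AMap F) (Hom C a b) (Hom D (OMap F a) (OMap F b)))"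

definition id_func :: "('o, 'm) func" where
  "id_func = \<lparr>OMap = (\<lambda>a. a), AMap = (\<lambda>f. f)\<rparr>"

definition comp_func ::
  "('o, 'm, 'x) func_scheme \<Rightarrow> ('o, 'm, 'w) func_scheme \<Rightarrow> ('o, 'm) func" where
  "comp_func G F = \<lparr>OMap = (\<lambda>a. OMap G (OMap F a)), AMap = (\<lambda>f. AMap G (AMap F f))\<rparr>"

definition is_nat_trans ::
  "('o, 'm, 'z) cat_scheme \<Rightarrow> ('o, 'm, 'y) cat_scheme \<Rightarrow>
   ('o, 'm, 'x) func_scheme \<Rightarrow> ('o, 'm, 'w) func_scheme \<Rightarrow> ('o \<Rightarrow> 'm) \<Rightarrow> bool" where
  "is_nat_trans C D F G \<tau> \<longleftrightarrow>
     (\<forall>a \<in> Obj C. \<tau> a \<in> Hom D (OMap F a) (OMap G a)) \<and>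
     (\<forall>a b. \<forall>f \<in> Hom C a b. AMap G f \<cdot>\<^bsub>D\<^esub> \<tau> a = \<tau> b \<cdot>\<^bsub>D\<^esub> AMap F f)"

text \<open>\<open>F : C \<rightarrow> D\<close> is left adjoint to \<open>G : D \<rightarrow> C\<close> with unit \<open>\<eta>\<close> and counit \<open>\<epsilon>\<close>.\<close>

definition is_adjunction ::
  "('o, 'm, 'z) cat_scheme \<Rightarrow> ('o, 'm, 'y) cat_scheme \<Rightarrow>
   ('o, 'm, 'x) func_scheme \<Rightarrow> ('o, 'm, 'w) func_scheme \<Rightarrow> ('o \<Rightarrow> 'm) \<Rightarrow> ('o \<Rightarrow> 'm) \<Rightarrow> bool" where
  "is_adjunction C D F G \<eta> \<epsilon> \<longleftrightarrow>
     is_functor C D F \<and> is_functor D C G \<and>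
     is_nat_trans C C id_func (comp_func G F) \<eta> \<and>
     is_nat_trans D D (comp_func F G) id_func \<epsilon> \<and>
     (\<forall>a \<in> Obj C. \<epsilon> (OMap F a) \<cdot>\<^bsub>D\<^esub> AMap F (\<eta> a) = Ident D (OMap F a)) \<and>
     (\<forall>b \<in> Obj D. AMap G (\<epsilon> b) \<cdot>\<^bsub>C\<^esub> \<eta> (OMap G b) = Ident C (OMap G b))"


section \<open>Triangulated categories\<close>

record ('o, 'm) additive_cat = "('o, 'm) cat" +
  Add :: "'m \<Rightarrow> 'm \<Rightarrow> 'm" (infixl "\<boxplus>\<index>" 65)
  ZeroArr :: "'o \<Rightarrow> 'o \<Rightarrow> 'm"

text \<open>The additive group \<open>Hom(a, b)\<close>, packaged as a group of HOL-Algebra. The group operation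
  is therefore written multiplicatively; its \<open>\<one>\<close> is the zero arrow.\<close>

definition hom_group :: "('o, 'm, 'z) additive_cat_scheme \<Rightarrow> 'o \<Rightarrow> 'o \<Rightarrow> 'm monoid" where
  "hom_group C a b = \<lparr>carrier = Hom C a b, monoid.mult = Add C, one = ZeroArr C a b\<rparr>"

definition neg_arr :: "('o, 'm, 'z) additive_cat_scheme \<Rightarrow> 'm \<Rightarrow> 'm" where
  "neg_arr C f = inv\<^bsub>hom_group C (Dom C f) (Cod C f)\<^esub> f"

locale additive_category = category C
  for C :: "('o, 'm, 'z) additive_cat_scheme" (structure) +
  assumes hom_comm_group: "\<lbrakk>a \<in> Obj C; b \<in> Obj C\<rbrakk> \<Longrightarrow> comm_group (hom_group C a b)"
    and comp_add_left: "\<lbrakk>f \<in> Hom C a b; g \<in> Hom C b c; g' \<in> Hom C b c\<rbrakk>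
      \<Longrightarrow> (g \<boxplus> g') \<cdot> f = (g \<cdot> f) \<boxplus> (g' \<cdot> f)"
    and comp_add_right: "\<lbrakk>f \<in> Hom C a b; f' \<in> Hom C a b; g \<in> Hom C b c\<rbrakk>
      \<Longrightarrow> g \<cdot> (f \<boxplus> f') = (g \<cdot> f) \<boxplus> (g \<cdot> f')"
    and zero_object: "\<exists>z. is_zero_object C z"
    and biproduct: "\<lbrakk>a \<in> Obj C; b \<in> Obj C\<rbrakk> \<Longrightarrow>
      \<exists>c \<in> Obj C. \<exists>p \<in> Hom C c a. \<exists>q \<in> Hom C c b. \<exists>k \<in> Hom C a c. \<exists>l \<in> Hom C b c.
        p \<cdot> k = Ident C a \<and> q \<cdot> l = Ident C b \<and>
        p \<cdot> l = ZeroArr C b a \<and> q \<cdot> k = ZeroArr C a b \<and>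
        (k \<cdot> p) \<boxplus> (l \<cdot> q) = Ident C c"

text \<open>\<open>ShO C n a\<close> is \<open>a[n]\<close>. Translation is a strict action of the integers by additive
  automorphisms. A triangle \<open>a \<rightarrow> b \<rightarrow> c \<rightarrow> a[1]\<close> is given by its three arrows.\<close>

record ('o, 'm) tri_cat = "('o, 'm) additive_cat" +
  ShO :: "int \<Rightarrow> 'o \<Rightarrow> 'o"
  ShA :: "int \<Rightarrow> 'm \<Rightarrow> 'm"
  Dist :: "('m \<times> 'm \<times> 'm) set"

definition shift :: "('o, 'm, 'z) tri_cat_scheme \<Rightarrow> int \<Rightarrow> ('o, 'm) func" where
  "shift C n = \<lparr>OMap = ShO C n, AMap = ShA C n\<rparr>"

definition is_triangle :: "('o, 'm, 'z) tri_cat_scheme \<Rightarrow> 'm \<Rightarrow> 'm \<Rightarrow> 'm \<Rightarrow> bool" where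
  "is_triangle C f g h \<longleftrightarrow>
     (\<exists>a b c. f \<in> Hom C a b \<and> g \<in> Hom C b c \<and> h \<in> Hom C c (ShO C 1 a))"

locale triangulated_category = additive_category C
  for C :: "('o, 'm, 'z) tri_cat_scheme" (structure) +
  assumes shift_functor: "is_functor C C (shift C n)"
    and shift_0_obj: "a \<in> Obj C \<Longrightarrow> ShO C 0 a = a"
    and shift_0_arr: "f \<in> Arr C \<Longrightarrow> ShA C 0 f = f"
    and shift_add_obj: "a \<in> Obj C \<Longrightarrow> ShO C m (ShO C n a) = ShO C (m + n) a"
    and shift_add_arr: "f \<in> Arr C \<Longrightarrow> ShA C m (ShA C n f) = ShA C (m + n) f"
    and shift_additive: "\<lbrakk>f \<in> Hom C a b; f' \<in> Hom C a b\<rbrakk>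
      \<Longrightarrow> ShA C n (f \<boxplus> f') = ShA C n f \<boxplus> ShA C n f'"
    and dist_triangle: "(f, g, h) \<in> Dist C \<Longrightarrow> is_triangle C f g h"
    and TR1_iso: "\<lbrakk>(f, g, h) \<in> Dist C; is_triangle C f' g' h';
        u \<in> Hom C (Dom C f) (Dom C f'); v \<in> Hom C (Dom C g) (Dom C g');
        w \<in> Hom C (Dom C h) (Dom C h'); is_iso C u; is_iso C v; is_iso C w;
        v \<cdot> f = f' \<cdot> u; w \<cdot> g = g' \<cdot> v; ShA C 1 u \<cdot> h = h' \<cdot> w\<rbrakk>
      \<Longrightarrow> (f', g', h') \<in> Dist C"
    and TR1_ident: "\<lbrakk>a \<in> Obj C; is_zero_object C z\<rbrakk>
      \<Longrightarrow> (Ident C a, ZeroArr C a z, ZeroArr C z (ShO C 1 a)) \<in> Dist C"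
    and TR1_cone: "f \<in> Arr C \<Longrightarrow> \<exists>g h. (f, g, h) \<in> Dist C"
    and TR2: "is_triangle C f g h \<Longrightarrow>
      (f, g, h) \<in> Dist C \<longleftrightarrow> (g, h, neg_arr C (ShA C 1 f)) \<in> Dist C"
    and TR3: "\<lbrakk>(f, g, h) \<in> Dist C; (f', g', h') \<in> Dist C;
        u \<in> Hom C (Dom C f) (Dom C f'); v \<in> Hom C (Dom C g) (Dom C g'); v \<cdot> f = f' \<cdot> u\<rbrakk>
      \<Longrightarrow> \<exists>w \<in> Hom C (Dom C h) (Dom C h'). w \<cdot> g = g' \<cdot> v \<and> ShA C 1 u \<cdot> h = h' \<cdot> w"
    and TR4: "\<lbrakk>f \<in> Hom C a b; g \<in> Hom C b c;
        (f, p1, d1) \<in> Dist C; (g \<cdot> f, p2, d2) \<in> Dist C; (g, p3, d3) \<in> Dist C\<rbrakk>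
      \<Longrightarrow> \<exists>s \<in> Hom C (Cod C p1) (Cod C p2). \<exists>t \<in> Hom C (Cod C p2) (Cod C p3).
            (s, t, ShA C 1 p1 \<cdot> d3) \<in> Dist C \<and>
            s \<cdot> p1 = p2 \<cdot> g \<and> d2 \<cdot> s = d1 \<and> t \<cdot> p2 = p3 \<and> d3 \<cdot> t = ShA C 1 f \<cdot> d2"

text \<open>An exact functor is an additive functor together with natural isomorphisms
  \<open>Xi F a : F(a[1]) \<rightarrow> F(a)[1]\<close> such that \<open>F\<close> preserves distinguished triangles.\<close>

record ('o, 'm) exact_func = "('o, 'm) func" +
  Xi :: "'o \<Rightarrow> 'm"

definition is_exact_functor ::
  "('o, 'm, 'z) tri_cat_scheme \<Rightarrow> ('o, 'm, 'y) tri_cat_scheme \<Rightarrow>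
   ('o, 'm, 'x) exact_func_scheme \<Rightarrow> bool" where
  "is_exact_functor C D F \<longleftrightarrow>
     is_functor C D F \<and>
     (\<forall>a b. \<forall>f \<in> Hom C a b. \<forall>g \<in> Hom C a b. AMap F (f \<boxplus>\<^bsub>C\<^esub> g) = AMap F f \<boxplus>\<^bsub>D\<^esub> AMap F g) \<and>
     is_nat_trans C D (comp_func F (shift C 1)) (comp_func (shift D 1) F) (Xi F) \<and>
     (\<forall>a \<in> Obj C. is_iso D (Xi F a)) \<and>
     (\<forall>f g h. (f, g, h) \<in> Dist C \<longrightarrow>
        (AMap F f, AMap F g, Xi F (Dom C f) \<cdot>\<^bsub>D\<^esub> AMap F h) \<in> Dist D)"

text \<open>The isomorphism \<open>F(a[n]) \<rightarrow> F(a)[n]\<close> obtained by iterating \<open>Xi\<close>. For \<open>n < 0\<close>, the arrow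
  for \<open>-n\<close> at \<open>a[n]\<close> is \<open>F(a) \<rightarrow> F(a[n])[-n]\<close>; shift it by \<open>n\<close> and invert.\<close>

primrec shift_iso_nat ::
  "('o, 'm, 'z) tri_cat_scheme \<Rightarrow> ('o, 'm, 'y) tri_cat_scheme \<Rightarrow>
   ('o, 'm, 'x) exact_func_scheme \<Rightarrow> nat \<Rightarrow> 'o \<Rightarrow> 'm" where
  "shift_iso_nat C D F 0 a = Ident D (OMap F a)"
| "shift_iso_nat C D F (Suc n) a =
     ShA D (int n) (Xi F a) \<cdot>\<^bsub>D\<^esub> shift_iso_nat C D F n (ShO C 1 a)"

definition shift_iso ::
  "('o, 'm, 'z) tri_cat_scheme \<Rightarrow> ('o, 'm, 'y) tri_cat_scheme \<Rightarrow>
   ('o, 'm, 'x) exact_func_scheme \<Rightarrow> int \<Rightarrow> 'o \<Rightarrow> 'm" where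
  "shift_iso C D F n a =
     (if 0 \<le> n then shift_iso_nat C D F (nat n) a
      else inv_arr D (ShA D n (shift_iso_nat C D F (nat (- n)) (ShO C n a))))"

text \<open>Adjunctions between exact functors are taken in the sense of triangulated functors: the
  unit \<open>a \<rightarrow> GFa\<close> commutes with the shift isomorphisms. Equivalently, the shift isomorphism of
  the right adjoint is the mate of that of the left adjoint.\<close>

definition is_exact_adjunction ::
  "('o, 'm, 'z) tri_cat_scheme \<Rightarrow> ('o, 'm, 'y) tri_cat_scheme \<Rightarrow>
   ('o, 'm, 'x) exact_func_scheme \<Rightarrow> ('o, 'm, 'w) exact_func_scheme \<Rightarrow>
   ('o \<Rightarrow> 'm) \<Rightarrow> ('o \<Rightarrow> 'm) \<Rightarrow> bool" where
  "is_exact_adjunction C D F G \<eta> \<epsilon> \<longleftrightarrow>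
     is_exact_functor C D F \<and> is_exact_functor D C G \<and> is_adjunction C D F G \<eta> \<epsilon> \<and>
     (\<forall>a \<in> Obj C. Xi G (OMap F a) \<cdot>\<^bsub>C\<^esub> AMap G (Xi F a) \<cdot>\<^bsub>C\<^esub> \<eta> (ShO C 1 a) = ShA C 1 (\<eta> a))"


section \<open>Symmetric monoidal structures\<close>

record ('o, 'm) sm_tri_cat = "('o, 'm) tri_cat" +
  TensO :: "'o \<Rightarrow> 'o \<Rightarrow> 'o" (infixr "\<otimes>\<^sub>O\<index>" 70)
  TensA :: "'m \<Rightarrow> 'm \<Rightarrow> 'm" (infixr "\<otimes>\<^sub>A\<index>" 80)
  One :: "'o"
  Assoc :: "'o \<Rightarrow> 'o \<Rightarrow> 'o \<Rightarrow> 'm"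
  LUnit :: "'o \<Rightarrow> 'm"
  RUnit :: "'o \<Rightarrow> 'm"
  Braid :: "'o \<Rightarrow> 'o \<Rightarrow> 'm"

locale symmetric_monoidal_category = category C
  for C :: "('o, 'm, 'z) sm_tri_cat_scheme" (structure) +
  assumes one_obj: "One C \<in> Obj C"
    and tens_obj: "\<lbrakk>a \<in> Obj C; b \<in> Obj C\<rbrakk> \<Longrightarrow> a \<otimes>\<^sub>O b \<in> Obj C"
    and tens_hom: "\<lbrakk>f \<in> Hom C a a'; g \<in> Hom C b b'\<rbrakk> \<Longrightarrow> f \<otimes>\<^sub>A g \<in> Hom C (a \<otimes>\<^sub>O b) (a' \<otimes>\<^sub>O b')"
    and tens_ident: "\<lbrakk>a \<in> Obj C; b \<in> Obj C\<rbrakk> \<Longrightarrow> Ident C a \<otimes>\<^sub>A Ident C b = Ident C (a \<otimes>\<^sub>O b)"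
    and tens_comp: "\<lbrakk>f \<in> Hom C a a'; f' \<in> Hom C a' a''; g \<in> Hom C b b'; g' \<in> Hom C b' b''\<rbrakk>
      \<Longrightarrow> (f' \<cdot> f) \<otimes>\<^sub>A (g' \<cdot> g) = (f' \<otimes>\<^sub>A g') \<cdot> (f \<otimes>\<^sub>A g)"
    and assoc_hom: "\<lbrakk>a \<in> Obj C; b \<in> Obj C; c \<in> Obj C\<rbrakk>
      \<Longrightarrow> Assoc C a b c \<in> Hom C ((a \<otimes>\<^sub>O b) \<otimes>\<^sub>O c) (a \<otimes>\<^sub>O (b \<otimes>\<^sub>O c)) \<and> is_iso C (Assoc C a b c)"
    and assoc_natural: "\<lbrakk>f \<in> Hom C a a'; g \<in> Hom C b b'; h \<in> Hom C c c'\<rbrakk>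
      \<Longrightarrow> (f \<otimes>\<^sub>A (g \<otimes>\<^sub>A h)) \<cdot> Assoc C a b c = Assoc C a' b' c' \<cdot> ((f \<otimes>\<^sub>A g) \<otimes>\<^sub>A h)"
    and lunit_hom: "a \<in> Obj C \<Longrightarrow> LUnit C a \<in> Hom C (One C \<otimes>\<^sub>O a) a \<and> is_iso C (LUnit C a)"
    and lunit_natural: "f \<in> Hom C a b \<Longrightarrow> f \<cdot> LUnit C a = LUnit C b \<cdot> (Ident C (One C) \<otimes>\<^sub>A f)"
    and runit_hom: "a \<in> Obj C \<Longrightarrow> RUnit C a \<in> Hom C (a \<otimes>\<^sub>O One C) a \<and> is_iso C (RUnit C a)"
    and runit_natural: "f \<in> Hom C a b \<Longrightarrow> f \<cdot> RUnit C a = RUnit C b \<cdot> (f \<otimes>\<^sub>A Ident C (One C))"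
    and braid_hom: "\<lbrakk>a \<in> Obj C; b \<in> Obj C\<rbrakk> \<Longrightarrow> Braid C a b \<in> Hom C (a \<otimes>\<^sub>O b) (b \<otimes>\<^sub>O a)"
    and braid_natural: "\<lbrakk>f \<in> Hom C a a'; g \<in> Hom C b b'\<rbrakk>
      \<Longrightarrow> (g \<otimes>\<^sub>A f) \<cdot> Braid C a b = Braid C a' b' \<cdot> (f \<otimes>\<^sub>A g)"
    and symmetry: "\<lbrakk>a \<in> Obj C; b \<in> Obj C\<rbrakk> \<Longrightarrow> Braid C b a \<cdot> Braid C a b = Ident C (a \<otimes>\<^sub>O b)"
    and unit_coherence: "\<lbrakk>a \<in> Obj C; b \<in> Obj C\<rbrakk>
      \<Longrightarrow> (Ident C a \<otimes>\<^sub>A LUnit C b) \<cdot> Assoc C a (One C) b = RUnit C a \<otimes>\<^sub>A Ident C b"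
    and pentagon: "\<lbrakk>a \<in> Obj C; b \<in> Obj C; c \<in> Obj C; d \<in> Obj C\<rbrakk>
      \<Longrightarrow> (Ident C a \<otimes>\<^sub>A Assoc C b c d) \<cdot> Assoc C a (b \<otimes>\<^sub>O c) d \<cdot> (Assoc C a b c \<otimes>\<^sub>A Ident C d)
          = Assoc C a b (c \<otimes>\<^sub>O d) \<cdot> Assoc C (a \<otimes>\<^sub>O b) c d"
    and hexagon: "\<lbrakk>a \<in> Obj C; b \<in> Obj C; c \<in> Obj C\<rbrakk>
      \<Longrightarrow> Assoc C b c a \<cdot> Braid C a (b \<otimes>\<^sub>O c) \<cdot> Assoc C a b c
          = (Ident C b \<otimes>\<^sub>A Braid C a c) \<cdot> Assoc C b a c \<cdot> (Braid C a b \<otimes>\<^sub>A Ident C c)"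

text \<open>Structure maps of a strong symmetric monoidal exact functor \<open>F\<close>:
  \<open>MuUnit F : 1 \<rightarrow> F(1)\<close> and \<open>Mu F a b : F(a) \<otimes> F(b) \<rightarrow> F(a \<otimes> b)\<close>.\<close>

record ('o, 'm) sm_exact_func = "('o, 'm) exact_func" +
  MuUnit :: "'m"
  Mu :: "'o \<Rightarrow> 'o \<Rightarrow> 'm"

definition is_symmetric_monoidal_functor ::
  "('o, 'm, 'z) sm_tri_cat_scheme \<Rightarrow> ('o, 'm, 'y) sm_tri_cat_scheme \<Rightarrow>
   ('o, 'm, 'x) sm_exact_func_scheme \<Rightarrow> bool" where
  "is_symmetric_monoidal_functor C D F \<longleftrightarrow>
     is_functor C D F \<and>
     MuUnit F \<in> Hom D (One D) (OMap F (One C)) \<and> is_iso D (MuUnit F) \<and>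
     (\<forall>a \<in> Obj C. \<forall>b \<in> Obj C.
        Mu F a b \<in> Hom D (OMap F a \<otimes>\<^sub>O\<^bsub>D\<^esub> OMap F b) (OMap F (a \<otimes>\<^sub>O\<^bsub>C\<^esub> b)) \<and> is_iso D (Mu F a b)) \<and>
     (\<forall>a a' b b'. \<forall>f \<in> Hom C a a'. \<forall>g \<in> Hom C b b'.
        AMap F (f \<otimes>\<^sub>A\<^bsub>C\<^esub> g) \<cdot>\<^bsub>D\<^esub> Mu F a b = Mu F a' b' \<cdot>\<^bsub>D\<^esub> (AMap F f \<otimes>\<^sub>A\<^bsub>D\<^esub> AMap F g)) \<and>
     (\<forall>a \<in> Obj C. \<forall>b \<in> Obj C. \<forall>c \<in> Obj C.
        AMap F (Assoc C a b c) \<cdot>\<^bsub>D\<^esub> Mu F (a \<otimes>\<^sub>O\<^bsub>C\<^esub> b) c \<cdot>\<^bsub>D\<^esub> (Mu F a b \<otimes>\<^sub>A\<^bsub>D\<^esub> Ident D (OMap F c))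
        = Mu F a (b \<otimes>\<^sub>O\<^bsub>C\<^esub> c) \<cdot>\<^bsub>D\<^esub> (Ident D (OMap F a) \<otimes>\<^sub>A\<^bsub>D\<^esub> Mu F b c) \<cdot>\<^bsub>D\<^esub>
          Assoc D (OMap F a) (OMap F b) (OMap F c)) \<and>
     (\<forall>a \<in> Obj C.
        AMap F (LUnit C a) \<cdot>\<^bsub>D\<^esub> Mu F (One C) a \<cdot>\<^bsub>D\<^esub> (MuUnit F \<otimes>\<^sub>A\<^bsub>D\<^esub> Ident D (OMap F a))
        = LUnit D (OMap F a)) \<and>
     (\<forall>a \<in> Obj C.
        AMap F (RUnit C a) \<cdot>\<^bsub>D\<^esub> Mu F a (One C) \<cdot>\<^bsub>D\<^esub> (Ident D (OMap F a) \<otimes>\<^sub>A\<^bsub>D\<^esub> MuUnit F)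
        = RUnit D (OMap F a)) \<and>
     (\<forall>a \<in> Obj C. \<forall>b \<in> Obj C.
        AMap F (Braid C a b) \<cdot>\<^bsub>D\<^esub> Mu F a b = Mu F b a \<cdot>\<^bsub>D\<^esub> Braid D (OMap F a) (OMap F b))"


section \<open>Spaces\<close>

text \<open>A category of spaces is left abstract (schemes, complex analytic spaces, \<dots>) except for
  the underlying topological spaces and continuous maps, the set of regular points of each space,
  and the classes of closed and open immersions. Underlying maps only matter on the topspace.\<close>

record ('s, 'f, 'p) space_cat = "('s, 'f) cat" +
  Points :: "'s \<Rightarrow> 'p topology"
  PMap :: "'f \<Rightarrow> 'p \<Rightarrow> 'p"
  Reg :: "'s \<Rightarrow> 'p set"
  ClosedImm :: "'f set"
  OpenImm :: "'f set"

locale space_category = category S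
  for S :: "('s, 'f, 'p, 'z) space_cat_scheme" (structure) +
  assumes pmap_continuous: "f \<in> Hom S X Y \<Longrightarrow> continuous_map (Points S X) (Points S Y) (PMap S f)"
    and pmap_ident: "\<lbrakk>X \<in> Obj S; x \<in> topspace (Points S X)\<rbrakk> \<Longrightarrow> PMap S (Ident S X) x = x"
    and pmap_comp: "\<lbrakk>f \<in> Hom S X Y; g \<in> Hom S Y Z; x \<in> topspace (Points S X)\<rbrakk>
      \<Longrightarrow> PMap S (g \<cdot> f) x = PMap S g (PMap S f x)"
    and reg_subset: "X \<in> Obj S \<Longrightarrow> Reg S X \<subseteq> topspace (Points S X)"
    and closed_imm: "f \<in> ClosedImm S \<Longrightarrow> f \<in> Arr S \<and>
      embedding_map (Points S (Dom S f)) (Points S (Cod S f)) (PMap S f) \<and>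
      closed_map (Points S (Dom S f)) (Points S (Cod S f)) (PMap S f)"
    and open_imm: "f \<in> OpenImm S \<Longrightarrow> f \<in> Arr S \<and>
      embedding_map (Points S (Dom S f)) (Points S (Cod S f)) (PMap S f) \<and>
      open_map (Points S (Dom S f)) (Points S (Cod S f)) (PMap S f)"

definition pt_image :: "('s, 'f, 'p, 'z) space_cat_scheme \<Rightarrow> 'f \<Rightarrow> 'p set" where
  "pt_image S f = PMap S f ` topspace (Points S (Dom S f))"

definition Sing :: "('s, 'f, 'p, 'z) space_cat_scheme \<Rightarrow> 's \<Rightarrow> 'p set" where
  "Sing S X = topspace (Points S X) - Reg S X"

definition is_singular_space :: "('s, 'f, 'p, 'z) space_cat_scheme \<Rightarrow> 's \<Rightarrow> bool" where
  "is_singular_space S X \<longleftrightarrow> X \<in> Obj S \<and> Sing S X \<noteq> {}"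

definition singular_locus_immersion ::
  "('s, 'f, 'p, 'z) space_cat_scheme \<Rightarrow> 's \<Rightarrow> 'f \<Rightarrow> bool" where
  "singular_locus_immersion S X i \<longleftrightarrow> i \<in> ClosedImm S \<and> Cod S i = X \<and> pt_image S i = Sing S X"

definition regular_locus_immersion ::
  "('s, 'f, 'p, 'z) space_cat_scheme \<Rightarrow> 's \<Rightarrow> 'f \<Rightarrow> bool" where
  "regular_locus_immersion S X j \<longleftrightarrow> j \<in> OpenImm S \<and> Cod S j = X \<and> pt_image S j = Reg S X"


section \<open>Coefficient systems and recollements\<close>

record ('s, 'f, 'p, 'o, 'm) coeff_sys =
  Spaces :: "('s, 'f, 'p) space_cat"
  Coef :: "'s \<Rightarrow> ('o, 'm) sm_tri_cat"
  Pull :: "'f \<Rightarrow> ('o, 'm) sm_exact_func"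
  Push :: "'f \<Rightarrow> ('o, 'm) exact_func"
  PUnit :: "'f \<Rightarrow> 'o \<Rightarrow> 'm"
  PCounit :: "'f \<Rightarrow> 'o \<Rightarrow> 'm"

locale coefficient_system =
  fixes K :: "('s, 'f, 'p, 'o, 'm) coeff_sys"
  assumes spaces: "space_category (Spaces K)"
    and coef_triangulated: "X \<in> Obj (Spaces K) \<Longrightarrow> triangulated_category (Coef K X)"
    and coef_monoidal: "X \<in> Obj (Spaces K) \<Longrightarrow> symmetric_monoidal_category (Coef K X)"
    and pull_push: "f \<in> Hom (Spaces K) X Y \<Longrightarrow>
      is_exact_adjunction (Coef K Y) (Coef K X) (Pull K f) (Push K f) (PUnit K f) (PCounit K f)"
    and pull_monoidal: "f \<in> Hom (Spaces K) X Y \<Longrightarrow>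
      is_symmetric_monoidal_functor (Coef K Y) (Coef K X) (Pull K f)"

text \<open>The data that a recollement adds to \<open>i\<^sup>* \<stileturn> i\<^sub>*\<close> and \<open>j\<^sup>* \<stileturn> j\<^sub>*\<close>: the functors \<open>i\<^sup>!\<close> and \<open>j\<^sub>!\<close>,
  the adjunctions \<open>i\<^sub>* \<stileturn> i\<^sup>!\<close> and \<open>j\<^sub>! \<stileturn> j\<^sup>*\<close>, and the connecting arrows
  \<open>LowerBd M : i\<^sub>*i\<^sup>*M \<rightarrow> (j\<^sub>!j\<^sup>*M)[1]\<close> and \<open>UpperBd M : j\<^sub>*j\<^sup>*M \<rightarrow> (i\<^sub>*i\<^sup>!M)[1]\<close>.\<close>

record ('o, 'm) recoll =
  UpperShriek :: "('o, 'm) func"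
  LowerShriek :: "('o, 'm) func"
  USUnit :: "'o \<Rightarrow> 'm"
  USCounit :: "'o \<Rightarrow> 'm"
  LSUnit :: "'o \<Rightarrow> 'm"
  LSCounit :: "'o \<Rightarrow> 'm"
  LowerBd :: "'o \<Rightarrow> 'm"
  UpperBd :: "'o \<Rightarrow> 'm"

locale recollement =
  fixes K :: "('s, 'f, 'p, 'o, 'm) coeff_sys" and i j :: 'f and R :: "('o, 'm) recoll"
    and CX CZ CU :: "('o, 'm) sm_tri_cat"
  defines "CX \<equiv> Coef K (Cod (Spaces K) i)"
    and "CZ \<equiv> Coef K (Dom (Spaces K) i)"
    and "CU \<equiv> Coef K (Dom (Spaces K) j)"
  assumes closed_immersion: "i \<in> ClosedImm (Spaces K)"
    and open_immersion: "j \<in> OpenImm (Spaces K)"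
    and complement: "Cod (Spaces K) j = Cod (Spaces K) i"
      "pt_image (Spaces K) j =
         topspace (Points (Spaces K) (Cod (Spaces K) i)) - pt_image (Spaces K) i"
    and upper_shriek: "is_adjunction CZ CX (Push K i) (UpperShriek R) (USUnit R) (USCounit R)"
    and lower_shriek: "is_adjunction CU CX (LowerShriek R) (Pull K j) (LSUnit R) (LSCounit R)"
    and push_ff: "fully_faithful CZ CX (Push K i)"
    and lower_shriek_ff: "fully_faithful CU CX (LowerShriek R)"
    and pull_push_zero: "M \<in> Obj CZ \<Longrightarrow> is_zero_object CU (OMap (Pull K j) (OMap (Push K i) M))"
    and pull_shriek_zero: "M \<in> Obj CU \<Longrightarrow>
      is_zero_object CZ (OMap (Pull K i) (OMap (LowerShriek R) M))"
    and lower_bd_natural: "is_nat_trans CX CX (comp_func (Push K i) (Pull K i))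
      (comp_func (shift CX 1) (comp_func (LowerShriek R) (Pull K j))) (LowerBd R)"
    and lower_triangle: "M \<in> Obj CX \<Longrightarrow> (LSCounit R M, PUnit K i M, LowerBd R M) \<in> Dist CX"
    and upper_bd_natural: "is_nat_trans CX CX (comp_func (Push K j) (Pull K j))
      (comp_func (shift CX 1) (comp_func (Push K i) (UpperShriek R))) (UpperBd R)"
    and upper_triangle: "M \<in> Obj CX \<Longrightarrow> (USCounit R M, PUnit K j M, UpperBd R M) \<in> Dist CX"


section \<open>Cohomology and the localisation sequence\<close>

definition coh_group :: "('o, 'm) sm_tri_cat \<Rightarrow> 'o \<Rightarrow> int \<Rightarrow> 'm monoid" where
  "coh_group C A d = hom_group C (One C) (ShO C d A)"

definition supp_obj ::
  "('s, 'f, 'p, 'o, 'm) coeff_sys \<Rightarrow> 'f \<Rightarrow> ('o, 'm) recoll \<Rightarrow> 'o \<Rightarrow> 'o" where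
  "supp_obj K i R A = OMap (Push K i) (OMap (UpperShriek R) A)"

definition supp_coh_group ::
  "('s, 'f, 'p, 'o, 'm) coeff_sys \<Rightarrow> 'f \<Rightarrow> ('o, 'm) recoll \<Rightarrow> 'o \<Rightarrow> int \<Rightarrow> 'm monoid" where
  "supp_coh_group K i R A d = coh_group (Coef K (Cod (Spaces K) i)) (supp_obj K i R A) d"

definition forg ::
  "('s, 'f, 'p, 'o, 'm) coeff_sys \<Rightarrow> 'f \<Rightarrow> ('o, 'm) recoll \<Rightarrow> 'o \<Rightarrow> int \<Rightarrow> 'm \<Rightarrow> 'm" where
  "forg K i R A d x =
     (let CX = Coef K (Cod (Spaces K) i) in ShA CX d (USCounit R A) \<cdot>\<^bsub>CX\<^esub> x)"

text \<open>Restriction sends \<open>x : 1 \<rightarrow> A[d]\<close> to \<open>1 \<cong> j\<^sup>*1 \<rightarrow> j\<^sup>*(A[d]) \<cong> (j\<^sup>*A)[d]\<close>.\<close>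

definition restr ::
  "('s, 'f, 'p, 'o, 'm) coeff_sys \<Rightarrow> 'f \<Rightarrow> 'o \<Rightarrow> int \<Rightarrow> 'm \<Rightarrow> 'm" where
  "restr K j A d x =
     (let CX = Coef K (Cod (Spaces K) j); CU = Coef K (Dom (Spaces K) j)
      in shift_iso CX CU (Pull K j) d A \<cdot>\<^bsub>CU\<^esub> AMap (Pull K j) x \<cdot>\<^bsub>CU\<^esub> MuUnit (Pull K j))"

text \<open>The identification \<open>Hom(1, (j\<^sup>*A)[d]) \<cong> Hom(1, (j\<^sub>*j\<^sup>*A)[d])\<close>, sending \<open>y\<close> to
  \<open>1 \<rightarrow> j\<^sub>*j\<^sup>*1 \<cong> j\<^sub>*1 \<rightarrow> j\<^sub>*((j\<^sup>*A)[d]) \<cong> (j\<^sub>*j\<^sup>*A)[d]\<close>.\<close>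

definition adjoint_class ::
  "('s, 'f, 'p, 'o, 'm) coeff_sys \<Rightarrow> 'f \<Rightarrow> 'o \<Rightarrow> int \<Rightarrow> 'm \<Rightarrow> 'm" where
  "adjoint_class K j A d y =
     (let CX = Coef K (Cod (Spaces K) j); CU = Coef K (Dom (Spaces K) j)
      in shift_iso CU CX (Push K j) d (OMap (Pull K j) A) \<cdot>\<^bsub>CX\<^esub>
         AMap (Push K j) (y \<cdot>\<^bsub>CU\<^esub> inv_arr CU (MuUnit (Pull K j))) \<cdot>\<^bsub>CX\<^esub>
         PUnit K j (One CX))"

text \<open>The connecting map \<open>H\<^sup>d(U; j\<^sup>*A) \<rightarrow> H\<^sub>Z\<^sup>d\<^sup>+\<^sup>1(X; A)\<close>, without the sign \<open>(-1)\<^sup>d\<close> that some authors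
  insert; it affects neither kernel nor image.\<close>

definition delta ::
  "('s, 'f, 'p, 'o, 'm) coeff_sys \<Rightarrow> 'f \<Rightarrow> ('o, 'm) recoll \<Rightarrow> 'o \<Rightarrow> int \<Rightarrow> 'm \<Rightarrow> 'm" where
  "delta K j R A d y =
     (let CX = Coef K (Cod (Spaces K) j)
      in ShA CX d (UpperBd R A) \<cdot>\<^bsub>CX\<^esub> adjoint_class K j A d y)"

text \<open>Graded versions: \<open>H\<^sup>*\<close> is the direct sum of the \<open>H\<^sup>d\<close> over an arbitrary set \<open>D\<close> of relevant
  degrees. For \<open>H\<^sup>*\<^sup>-\<^sup>1\<close> the degrees are those \<open>d\<close> with \<open>d + 1 \<in> D\<close>.\<close>

definition graded_coh :: "('o, 'm) sm_tri_cat \<Rightarrow> int set \<Rightarrow> 'o \<Rightarrow> (int \<Rightarrow> 'm) monoid" where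
  "graded_coh C D A = sum_group D (coh_group C A)"

definition graded_supp_coh ::
  "('s, 'f, 'p, 'o, 'm) coeff_sys \<Rightarrow> 'f \<Rightarrow> ('o, 'm) recoll \<Rightarrow> int set \<Rightarrow> 'o \<Rightarrow> (int \<Rightarrow> 'm) monoid" where
  "graded_supp_coh K i R D A = sum_group D (supp_coh_group K i R A)"

definition graded_forg ::
  "('s, 'f, 'p, 'o, 'm) coeff_sys \<Rightarrow> 'f \<Rightarrow> ('o, 'm) recoll \<Rightarrow> int set \<Rightarrow> 'o \<Rightarrow>
   (int \<Rightarrow> 'm) \<Rightarrow> (int \<Rightarrow> 'm)" where
  "graded_forg K i R D A x = (\<lambda>d\<in>D. forg K i R A d (x d))"

definition graded_restr ::
  "('s, 'f, 'p, 'o, 'm) coeff_sys \<Rightarrow> 'f \<Rightarrow> int set \<Rightarrow> 'o \<Rightarrow> (int \<Rightarrow> 'm) \<Rightarrow> (int \<Rightarrow> 'm)" where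
  "graded_restr K j D A x = (\<lambda>d\<in>D. restr K j A d (x d))"

definition graded_delta ::
  "('s, 'f, 'p, 'o, 'm) coeff_sys \<Rightarrow> 'f \<Rightarrow> ('o, 'm) recoll \<Rightarrow> int set \<Rightarrow> 'o \<Rightarrow>
   (int \<Rightarrow> 'm) \<Rightarrow> (int \<Rightarrow> 'm)" where
  "graded_delta K j R D A y = (\<lambda>d\<in>D. delta K j R A (d - 1) (y (d - 1)))"


section \<open>Milnor defects and their supported refinements\<close>

text \<open>A characteristic theory enters only through its two classes on the given space.\<close>

record 'm char_classes =
  Class :: "int \<Rightarrow> 'm"
  VirClass :: "int \<Rightarrow> 'm"

definition has_values_in :: "'m char_classes \<Rightarrow> (int \<Rightarrow> 'm) monoid \<Rightarrow> bool" where
  "has_values_in c H \<longleftrightarrow> Class c \<in> carrier H \<and> VirClass c \<in> carrier H"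

definition milnor_defect :: "(int \<Rightarrow> 'm) monoid \<Rightarrow> 'm char_classes \<Rightarrow> (int \<Rightarrow> 'm)" where
  "milnor_defect H c = VirClass c \<otimes>\<^bsub>H\<^esub> inv\<^bsub>H\<^esub> Class c"

definition milnor_torsor ::
  "('s, 'f, 'p, 'o, 'm) coeff_sys \<Rightarrow> 'f \<Rightarrow> ('o, 'm) recoll \<Rightarrow> int set \<Rightarrow> 'o \<Rightarrow>
   'm char_classes \<Rightarrow> (int \<Rightarrow> 'm) set" where
  "milnor_torsor K i R D A c =
     {m \<in> carrier (graded_supp_coh K i R D A).
        graded_forg K i R D A m =
          milnor_defect (graded_coh (Coef K (Cod (Spaces K) i)) D A) c}"

definition ambiguity_group ::
  "('s, 'f, 'p, 'o, 'm) coeff_sys \<Rightarrow> 'f \<Rightarrow> ('o, 'm) recoll \<Rightarrow> int set \<Rightarrow> 'o \<Rightarrow> (int \<Rightarrow> 'm) set" where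
  "ambiguity_group K j R D A =
     graded_delta K j R D A `
       carrier (graded_coh (Coef K (Dom (Spaces K) j)) {d. d + 1 \<in> D} (OMap (Pull K j) A))"

end

theory Submission
  imports Defs
begin

text \<open>
  Taking \<open>Hom(1, -)\<close> of the shifts of \<open>i\<^sub>*i\<^sup>!A \<rightarrow> A \<rightarrow> j\<^sub>*j\<^sup>*A\<close> gives a long exact sequence.
  Adjunction identifies its third term with \<open>H\<^sup>*(U; j\<^sup>*A)\<close>, so that \<open>\<delta>\<close> has image the kernel of
  \<open>forg\<close>, while two classes with the same restriction to \<open>U\<close> become equal under the unit and hence
  differ by an element of the image of \<open>forg\<close>. The Milnor torsor is therefore a nonempty fibre of the
  homomorphism \<open>forg\<close>, a coset of the ambiguity group.
\<close>

text \<open>The delicate point is that exactness concerns composition with the translated unit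
  \<eta>(A)[d], whereas \<open>restr\<close> applies the pullback to arrows and then composes with
  comparison isomorphisms. An exact adjunction relates its unit to translation by 1 only, so the
  relation has to be extended to every integer, negative ones included. It suffices that some
  isomorphism \<phi> satisfies \<phi> \<cdot> \<eta>(a[d]) = \<eta>(a)[d]: the effect of
  \<eta>(a)[d] on an arrow then depends only on the pullback of that arrow. The comparison maps
  inside \<open>restr\<close> and \<open>adjoint_class\<close> are thus never computed; being
  invertible, they cancel. Rotating triangles creates signs, which kernels and images do not see.
  Passing to direct sums costs one further argument: degreewise preimages must be chosen with finite
  support.\<close>

section \<open>Arrows and isomorphisms\<close>

lemma functor_obj: "\<lbrakk>is_functor C E F; a \<in> Obj C\<rbrakk> \<Longrightarrow> OMap F a \<in> Obj E"
  and functor_hom: "\<lbrakk>is_functor C E F; f \<in> Hom C a b\<rbrakk> \<Longrightarrow> AMap F f \<in> Hom E (OMap F a) (OMap F b)"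
  and functor_ident: "\<lbrakk>is_functor C E F; a \<in> Obj C\<rbrakk> \<Longrightarrow> AMap F (Ident C a) = Ident E (OMap F a)"
  and functor_comp: "\<lbrakk>is_functor C E F; f \<in> Hom C a b; g \<in> Hom C b c\<rbrakk> \<Longrightarrow>
    AMap F (g \<cdot>\<^bsub>C\<^esub> f) = AMap F g \<cdot>\<^bsub>E\<^esub> AMap F f"
  unfolding is_functor_def by blast+

context category
begin

lemma hom_dom_obj: "f \<in> Hom C a b \<Longrightarrow> a \<in> Obj C"
  using dom_obj by (auto simp: Hom_def)

lemma hom_cod_obj: "f \<in> Hom C a b \<Longrightarrow> b \<in> Obj C"
  using cod_obj by (auto simp: Hom_def)

lemma is_isoI:
  assumes "f \<in> Hom C a b" "g \<in> Hom C b a" "g \<cdot> f = Ident C a" "f \<cdot> g = Ident C b"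
  shows "is_iso C f"
  using assms by (auto simp: is_iso_def inverse_arrows_def Hom_def)

lemma inverse_arrows_unique:
  assumes "inverse_arrows C f g" "inverse_arrows C f h"
  shows "g = h"
proof -
  have f: "f \<in> Hom C (Dom C f) (Cod C f)"
    using assms(1) by (simp add: inverse_arrows_def Hom_def)
  have g: "g \<in> Hom C (Cod C f) (Dom C f)" and h: "h \<in> Hom C (Cod C f) (Dom C f)"
    using assms by (auto simp: inverse_arrows_def)
  have "g = (h \<cdot> f) \<cdot> g"
    using assms(2) g ident_left by (simp add: inverse_arrows_def)
  also have "\<dots> = h \<cdot> (f \<cdot> g)"
    by (rule comp_assoc[OF g f h])
  also have "\<dots> = h"
    using assms(1) h ident_right by (simp add: inverse_arrows_def)
  finally show ?thesis .
qed

text \<open>\<open>inv_arr\<close> is a definite description, so its defining equations become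
  available only through uniqueness of inverses.\<close>

lemma inv_arr:
  assumes "is_iso C f" "f \<in> Hom C a b"
  shows "inv_arr C f \<in> Hom C b a" "inv_arr C f \<cdot> f = Ident C a" "f \<cdot> inv_arr C f = Ident C b"
proof -
  have "inverse_arrows C f (inv_arr C f)"
    unfolding inv_arr_def
    by (rule theI') (use assms(1) inverse_arrows_unique in \<open>auto simp: is_iso_def\<close>)
  then show "inv_arr C f \<in> Hom C b a" "inv_arr C f \<cdot> f = Ident C a" "f \<cdot> inv_arr C f = Ident C b"
    using assms(2) by (auto simp: inverse_arrows_def Hom_def)
qed

lemma is_iso_inv_arr:
  assumes "is_iso C f" "f \<in> Hom C a b"
  shows "is_iso C (inv_arr C f)"
  using is_isoI[OF inv_arr(1)[OF assms] assms(2)] inv_arr[OF assms] by simp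

lemma inv_arr_cancel_left:
  assumes "is_iso C f" "f \<in> Hom C a b" "g \<in> Hom C c a"
  shows "inv_arr C f \<cdot> (f \<cdot> g) = g"
  using comp_assoc[OF assms(3,2) inv_arr(1)[OF assms(1,2)]] inv_arr(2)[OF assms(1,2)]
    ident_left[OF assms(3)] by simp

lemma inv_arr_cancel_left':
  assumes "is_iso C f" "f \<in> Hom C a b" "g \<in> Hom C c b"
  shows "f \<cdot> (inv_arr C f \<cdot> g) = g"
  using comp_assoc[OF assms(3) inv_arr(1)[OF assms(1,2)] assms(2)] inv_arr(3)[OF assms(1,2)]
    ident_left[OF assms(3)] by simp

lemma inv_arr_cancel_right:
  assumes "is_iso C f" "f \<in> Hom C a b" "g \<in> Hom C b c"
  shows "(g \<cdot> f) \<cdot> inv_arr C f = g"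
  using comp_assoc[OF inv_arr(1)[OF assms(1,2)] assms(2,3)] inv_arr(3)[OF assms(1,2)]
    ident_right[OF assms(3)] by simp

lemma is_iso_comp:
  assumes "is_iso C f" "f \<in> Hom C a b" "is_iso C g" "g \<in> Hom C b c"
  shows "is_iso C (g \<cdot> f)"
proof (rule is_isoI)
  note f' = inv_arr[OF assms(1,2)] and g' = inv_arr[OF assms(3,4)]
  show "g \<cdot> f \<in> Hom C a c" "inv_arr C f \<cdot> inv_arr C g \<in> Hom C c a"
    using assms f' g' comp_hom by blast+
  show "(inv_arr C f \<cdot> inv_arr C g) \<cdot> (g \<cdot> f) = Ident C a"
    using comp_assoc[OF comp_hom[OF assms(2,4)] g'(1) f'(1)]
      inv_arr_cancel_left[OF assms(3,4,2)] f'(2) by simp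
  show "(g \<cdot> f) \<cdot> (inv_arr C f \<cdot> inv_arr C g) = Ident C c"
    using comp_assoc[OF comp_hom[OF g'(1) f'(1)] assms(2,4)]
      inv_arr_cancel_left'[OF assms(1,2) g'(1)] g'(3) by simp
qed

lemma iso_cancel_left:
  assumes "is_iso C f" "f \<in> Hom C a b" "g \<in> Hom C c a" "h \<in> Hom C c a" "f \<cdot> g = f \<cdot> h"
  shows "g = h"
  by (metis inv_arr_cancel_left[OF assms(1,2,3)] inv_arr_cancel_left[OF assms(1,2,4)] assms(5))

lemma iso_cancel_right:
  assumes "is_iso C f" "f \<in> Hom C a b" "g \<in> Hom C b c" "h \<in> Hom C b c" "g \<cdot> f = h \<cdot> f"
  shows "g = h"
  by (metis inv_arr_cancel_right[OF assms(1,2,3)] inv_arr_cancel_right[OF assms(1,2,4)] assms(5))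

lemma functor_is_iso:
  assumes "is_functor C E F" "category E" "is_iso C f" "f \<in> Hom C a b"
  shows "is_iso E (AMap F f)"
proof (rule category.is_isoI[OF assms(2)])
  note f' = inv_arr[OF assms(3,4)]
  show "AMap F f \<in> Hom E (OMap F a) (OMap F b)" "AMap F (inv_arr C f) \<in> Hom E (OMap F b) (OMap F a)"
    using functor_hom[OF assms(1)] assms(4) f'(1) by blast+
  show "AMap F (inv_arr C f) \<cdot>\<^bsub>E\<^esub> AMap F f = Ident E (OMap F a)"
    using functor_comp[OF assms(1,4) f'(1)] f'(2) functor_ident[OF assms(1) hom_dom_obj[OF assms(4)]]
    by simp
  show "AMap F f \<cdot>\<^bsub>E\<^esub> AMap F (inv_arr C f) = Ident E (OMap F b)"
    using functor_comp[OF assms(1) f'(1) assms(4)] f'(3) functor_ident[OF assms(1) hom_cod_obj[OF assms(4)]]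
    by simp
qed

end


section \<open>Long exact sequences of a distinguished triangle\<close>

lemma carrier_hom_group [simp]: "carrier (hom_group C a b) = Hom C a b"
  and one_hom_group [simp]: "\<one>\<^bsub>hom_group C a b\<^esub> = ZeroArr C a b"
  and mult_hom_group [simp]: "f \<otimes>\<^bsub>hom_group C a b\<^esub> g = f \<boxplus>\<^bsub>C\<^esub> g"
  by (simp_all add: hom_group_def)

context additive_category
begin

lemma hom_group_is_group: "\<lbrakk>a \<in> Obj C; b \<in> Obj C\<rbrakk> \<Longrightarrow> group (hom_group C a b)"
  using hom_comm_group comm_group_def by blast

lemma zero_hom: "\<lbrakk>a \<in> Obj C; b \<in> Obj C\<rbrakk> \<Longrightarrow> ZeroArr C a b \<in> Hom C a b"
  using monoid.one_closed[OF group.is_monoid[OF hom_group_is_group]] by simp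

text \<open>Packaging composition as a \<open>group_hom\<close> lets the algebra library supply its
  behaviour on zero arrows, negatives and differences.\<close>

lemma postcomp_group_hom:
  assumes "g \<in> Hom C b c" "a \<in> Obj C"
  shows "group_hom (hom_group C a b) (hom_group C a c) (\<lambda>f. g \<cdot> f)"
proof -
  have "group (hom_group C a b)" "group (hom_group C a c)"
    using hom_group_is_group assms(2) hom_dom_obj[OF assms(1)] hom_cod_obj[OF assms(1)] by blast+
  moreover have "(\<lambda>f. g \<cdot> f) \<in> hom (hom_group C a b) (hom_group C a c)"
    unfolding hom_def using comp_hom[OF _ assms(1)] comp_add_right[OF _ _ assms(1)] by simp
  ultimately show ?thesis
    by (simp add: group_hom_def group_hom_axioms_def)
qed

lemma precomp_group_hom:
  assumes "f \<in> Hom C a b" "c \<in> Obj C"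
  shows "group_hom (hom_group C b c) (hom_group C a c) (\<lambda>g. g \<cdot> f)"
proof -
  have "group (hom_group C b c)" "group (hom_group C a c)"
    using hom_group_is_group assms(2) hom_dom_obj[OF assms(1)] hom_cod_obj[OF assms(1)] by blast+
  moreover have "(\<lambda>g. g \<cdot> f) \<in> hom (hom_group C b c) (hom_group C a c)"
    unfolding hom_def using comp_hom[OF assms(1)] comp_add_left[OF assms(1)] by simp
  ultimately show ?thesis
    by (simp add: group_hom_def group_hom_axioms_def)
qed

lemma comp_zero_right: "\<lbrakk>g \<in> Hom C b c; a \<in> Obj C\<rbrakk> \<Longrightarrow> g \<cdot> ZeroArr C a b = ZeroArr C a c"
  using group_hom.hom_one[OF postcomp_group_hom] by simp

lemma comp_zero_left: "\<lbrakk>f \<in> Hom C a b; c \<in> Obj C\<rbrakk> \<Longrightarrow> ZeroArr C b c \<cdot> f = ZeroArr C a c"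
  using group_hom.hom_one[OF precomp_group_hom] by simp

text \<open>\<open>neg_arr\<close> reads its group off the endpoints of the arrow; here that group
  is pinned to a named hom-set, so that group lemmas apply.\<close>

lemma neg_arr_eq: "f \<in> Hom C a b \<Longrightarrow> neg_arr C f = inv\<^bsub>hom_group C a b\<^esub> f"
  by (auto simp: neg_arr_def Hom_def)

lemma neg_hom:
  assumes "f \<in> Hom C a b"
  shows "neg_arr C f \<in> Hom C a b"
  using group.inv_closed[OF hom_group_is_group[OF hom_dom_obj[OF assms] hom_cod_obj[OF assms]]] assms
  by (simp add: neg_arr_eq)

lemma neg_neg:
  assumes "f \<in> Hom C a b"
  shows "neg_arr C (neg_arr C f) = f"
  using group.inv_inv[OF hom_group_is_group[OF hom_dom_obj[OF assms] hom_cod_obj[OF assms]]] assms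
    neg_hom[OF assms] by (simp add: neg_arr_eq)

lemma neg_inj:
  assumes "f \<in> Hom C a b" "g \<in> Hom C a b" "neg_arr C f = neg_arr C g"
  shows "f = g"
  by (metis neg_neg[OF assms(1)] neg_neg[OF assms(2)] assms(3))

lemma neg_zero:
  assumes "a \<in> Obj C" "b \<in> Obj C"
  shows "neg_arr C (ZeroArr C a b) = ZeroArr C a b"
  using monoid.inv_one[OF group.is_monoid[OF hom_group_is_group[OF assms]]] zero_hom[OF assms]
  by (simp add: neg_arr_eq)

lemma comp_neg_left:
  assumes "f \<in> Hom C a b" "g \<in> Hom C b c"
  shows "neg_arr C g \<cdot> f = neg_arr C (g \<cdot> f)"
  using group_hom.hom_inv[OF precomp_group_hom[OF assms(1) hom_cod_obj[OF assms(2)]], of g] assms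
  by (simp add: neg_arr_eq[OF assms(2)] neg_arr_eq[OF comp_hom[OF assms]])

lemma comp_neg_right:
  assumes "f \<in> Hom C a b" "g \<in> Hom C b c"
  shows "g \<cdot> neg_arr C f = neg_arr C (g \<cdot> f)"
  using group_hom.hom_inv[OF postcomp_group_hom[OF assms(2) hom_dom_obj[OF assms(1)]], of f] assms
  by (simp add: neg_arr_eq[OF assms(1)] neg_arr_eq[OF comp_hom[OF assms]])

end

section \<open>Translation, and Hom(w, -) applied to a distinguished triangle\<close>

context triangulated_category
begin

lemma shift_obj: "a \<in> Obj C \<Longrightarrow> ShO C n a \<in> Obj C"
  using functor_obj[OF shift_functor[of n]] by (simp add: shift_def)

lemma shift_hom: "f \<in> Hom C a b \<Longrightarrow> ShA C n f \<in> Hom C (ShO C n a) (ShO C n b)"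
  using functor_hom[OF shift_functor[of n]] by (simp add: shift_def)

lemma shift_comp:
  "\<lbrakk>f \<in> Hom C a b; g \<in> Hom C b c\<rbrakk> \<Longrightarrow> ShA C n (g \<cdot> f) = ShA C n g \<cdot> ShA C n f"
  using functor_comp[OF shift_functor[of n], of f a b g c] by (simp add: shift_def)

lemma shift_ident: "a \<in> Obj C \<Longrightarrow> ShA C n (Ident C a) = Ident C (ShO C n a)"
  using functor_ident[OF shift_functor[of n]] by (simp add: shift_def)

lemma shift_is_iso: "\<lbrakk>is_iso C f; f \<in> Hom C a b\<rbrakk> \<Longrightarrow> is_iso C (ShA C n f)"
  using functor_is_iso[OF shift_functor category_axioms, of f a b n] by (simp add: shift_def)

lemma shift_shift: "f \<in> Hom C a b \<Longrightarrow> ShA C m (ShA C n f) = ShA C (m + n) f"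
  using shift_add_arr[of f m n] by (simp add: Hom_def)

lemma shift_neg_shift: "f \<in> Hom C a b \<Longrightarrow> ShA C n (ShA C (- n) f) = f"
  using shift_add_arr[of f n "- n"] shift_0_arr[of f] by (simp add: Hom_def)

lemma shift_neg_shift_obj: "a \<in> Obj C \<Longrightarrow> ShO C n (ShO C (- n) a) = a"
  using shift_add_obj[of a n "- n"] shift_0_obj[of a] by simp

text \<open>Translation is a strict action on arrows, so translating back recovers an arrow on the
  nose, with no comparison isomorphism.\<close>

lemma shift_inj:
  assumes "f \<in> Hom C a b" "g \<in> Hom C a' b'" "ShA C n f = ShA C n g"
  shows "f = g"
  by (metis shift_neg_shift[OF assms(1), of "- n"] shift_neg_shift[OF assms(2), of "- n"]
      add.inverse_inverse assms(3))

lemma shift_group_hom: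
  assumes "a \<in> Obj C" "b \<in> Obj C"
  shows "group_hom (hom_group C a b) (hom_group C (ShO C n a) (ShO C n b)) (ShA C n)"
proof -
  have "group (hom_group C a b)" "group (hom_group C (ShO C n a) (ShO C n b))"
    using hom_group_is_group assms shift_obj by blast+
  then show ?thesis
    by (simp add: group_hom_def group_hom_axioms_def hom_def shift_hom shift_additive)
qed

lemma shift_zero:
  assumes "a \<in> Obj C" "b \<in> Obj C"
  shows "ShA C n (ZeroArr C a b) = ZeroArr C (ShO C n a) (ShO C n b)"
  using group_hom.hom_one[OF shift_group_hom[OF assms]] by simp

lemma shift_neg:
  assumes "f \<in> Hom C a b"
  shows "ShA C n (neg_arr C f) = neg_arr C (ShA C n f)"
  using group_hom.hom_inv[OF shift_group_hom[OF hom_dom_obj[OF assms] hom_cod_obj[OF assms]]] assms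
  by (simp add: neg_arr_eq[OF assms] neg_arr_eq[OF shift_hom[OF assms]])

lemma dist_rotate:
  assumes "(f, g, h) \<in> Dist C"
  shows "(g, h, neg_arr C (ShA C 1 f)) \<in> Dist C"
  using TR2 assms dist_triangle by blast

text \<open>TR3 maps the triangle a = a \<rightarrow> 0 to the given one, with the identity and
  \<open>f\<close> as first two components. The square it produces factors
  \<open>g \<cdot> f\<close> through the zero object.\<close>

lemma dist_comp_zero:
  assumes "(f, g, h) \<in> Dist C" "f \<in> Hom C a b" "g \<in> Hom C b c"
  shows "g \<cdot> f = ZeroArr C a c"
proof -
  obtain z where z: "is_zero_object C z"
    using zero_object by blast
  have a: "a \<in> Obj C" and c: "c \<in> Obj C" and zo: "z \<in> Obj C"
    using hom_dom_obj[OF assms(2)] hom_cod_obj[OF assms(3)] z by (simp_all add: is_zero_object_def)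
  have h: "Dom C h = c"
    using dist_triangle[OF assms(1)] assms(3) by (auto simp: is_triangle_def Hom_def)
  have da: "Dom C (Ident C a) = a" "Dom C (ZeroArr C a z) = a" "Dom C (ZeroArr C z (ShO C 1 a)) = z"
    using ident_hom[OF a] zero_hom[OF a zo] zero_hom[OF zo shift_obj[OF a]] by (auto simp: Hom_def)
  have df: "Dom C f = a" "Dom C g = b"
    using assms by (auto simp: Hom_def)
  have "\<exists>w \<in> Hom C z c. w \<cdot> ZeroArr C a z = g \<cdot> f \<and> ShA C 1 (Ident C a) \<cdot> ZeroArr C z (ShO C 1 a) = h \<cdot> w"
    using TR3[OF TR1_ident[OF a z] assms(1), of "Ident C a" f] ident_hom[OF a] assms(2) da df h
    by simp
  then show ?thesis
    using comp_zero_right[OF _ a] by metis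
qed

text \<open>This is exactness of Hom(w, -) at b. TR3 fills in a third component only, while the
  arrow sought lies between first objects; both triangles are therefore rotated once, which turns it
  into a third component one translation up.\<close>

lemma dist_lift:
  assumes "(f, g, h) \<in> Dist C" "f \<in> Hom C a b" "g \<in> Hom C b c"
    and x: "x \<in> Hom C w b" "g \<cdot> x = ZeroArr C w c"
  shows "\<exists>y \<in> Hom C w a. f \<cdot> y = x"
proof -
  obtain z where z: "is_zero_object C z"
    using zero_object by blast
  have a: "a \<in> Obj C" and b: "b \<in> Obj C" and c: "c \<in> Obj C" and w: "w \<in> Obj C" and zo: "z \<in> Obj C"
    using hom_dom_obj[OF assms(2)] hom_dom_obj[OF assms(3)] hom_cod_obj[OF assms(3)]
      hom_dom_obj[OF x(1)] z by (simp_all add: is_zero_object_def)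
  have h: "h \<in> Hom C c (ShO C 1 a)"
    using dist_triangle[OF assms(1)] assms(2,3) by (auto simp: is_triangle_def Hom_def)
  let ?n = "neg_arr C (ShA C 1 (Ident C w))" and ?z = "ZeroArr C w z" and ?z' = "ZeroArr C z (ShO C 1 w)"
  let ?m = "neg_arr C (ShA C 1 f)"
  have idw: "ShA C 1 (Ident C w) \<in> Hom C (ShO C 1 w) (ShO C 1 w)"
    using shift_hom[OF ident_hom[OF w]] .
  have f1: "ShA C 1 f \<in> Hom C (ShO C 1 a) (ShO C 1 b)"
    using shift_hom[OF assms(2)] .
  have x1: "ShA C 1 x \<in> Hom C (ShO C 1 w) (ShO C 1 b)"
    using shift_hom[OF x(1)] .
  have T: "(?z, ?z', ?n) \<in> Dist C" and T': "(g, h, ?m) \<in> Dist C"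
    using dist_rotate TR1_ident[OF w z] assms(1) by blast+
  have d: "Dom C ?z = w" "Dom C ?z' = z" "Dom C ?n = ShO C 1 w"
    "Dom C g = b" "Dom C h = c" "Dom C ?m = ShO C 1 a"
    using zero_hom[OF w zo] zero_hom[OF zo shift_obj[OF w]] neg_hom[OF idw] assms(3) h neg_hom[OF f1]
    by (auto simp: Hom_def)
  have "ZeroArr C z c \<cdot> ?z = g \<cdot> x"
    using comp_zero_left[OF zero_hom[OF w zo] c] x by simp
  \<comment> \<open>\<open>v\<close> is the desired lift translated by 1. Both rotated triangles end
    in a negated arrow, so the two signs in its equation cancel.\<close>
  then obtain v where v: "v \<in> Hom C (ShO C 1 w) (ShO C 1 a)" "ShA C 1 x \<cdot> ?n = ?m \<cdot> v"
    using TR3[OF T T', of x "ZeroArr C z c"] d x zero_hom[OF zo c] by auto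
  have "neg_arr C (ShA C 1 x) = ShA C 1 x \<cdot> ?n"
    using comp_neg_right[OF idw x1] ident_right[OF x1] shift_ident[OF w] by simp
  also have "\<dots> = neg_arr C (ShA C 1 f \<cdot> v)"
    using comp_neg_left[OF v(1) f1] v(2) by simp
  finally have "ShA C 1 x = ShA C 1 f \<cdot> v"
    by (rule neg_inj[OF x1 comp_hom[OF v(1) f1]])
  moreover have v': "ShA C (-1) v \<in> Hom C w a"
    using shift_hom[OF v(1), of "-1"] shift_add_obj shift_0_obj w a by simp
  moreover have "ShA C 1 (f \<cdot> ShA C (-1) v) = ShA C 1 f \<cdot> v"
    using shift_comp[OF v' assms(2)] shift_neg_shift[OF v(1)] by simp
  ultimately have "f \<cdot> ShA C (-1) v = x"
    using shift_inj[OF comp_hom[OF v' assms(2)] x(1), of 1] by simp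
  then show ?thesis
    using v' by blast
qed

text \<open>A translated triangle is distinguished only after adjusting signs. To avoid this, the
  arrow \<open>x\<close> is translated back by -d, lifted along the original triangle, and the lift
  translated forward again.\<close>

lemma dist_lift_shift:
  assumes "(f, g, h) \<in> Dist C" "f \<in> Hom C a b" "g \<in> Hom C b c"
    and x: "x \<in> Hom C w (ShO C d b)" "ShA C d g \<cdot> x = ZeroArr C w (ShO C d c)"
  shows "\<exists>y \<in> Hom C w (ShO C d a). ShA C d f \<cdot> y = x"
proof -
  have a: "a \<in> Obj C" and b: "b \<in> Obj C" and c: "c \<in> Obj C" and w: "w \<in> Obj C"
    using assms hom_dom_obj hom_cod_obj by blast+
  have x': "ShA C (- d) x \<in> Hom C (ShO C (- d) w) b"
    using shift_hom[OF x(1), of "- d"] shift_add_obj shift_0_obj b by simp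
  have "ShA C d (g \<cdot> ShA C (- d) x) = ShA C d (ZeroArr C (ShO C (- d) w) c)"
    using shift_comp[OF x' assms(3)] shift_neg_shift[OF x(1)] x(2)
      shift_zero[OF shift_obj[OF w] c] shift_neg_shift_obj[OF w] by simp
  then have "g \<cdot> ShA C (- d) x = ZeroArr C (ShO C (- d) w) c"
    by (rule shift_inj[OF comp_hom[OF x' assms(3)] zero_hom[OF shift_obj[OF w] c]])
  then obtain y where y: "y \<in> Hom C (ShO C (- d) w) a" "f \<cdot> y = ShA C (- d) x"
    using dist_lift[OF assms(1-3) x'] by blast
  have "ShA C d f \<cdot> ShA C d y = x"
    using shift_comp[OF y(1) assms(2), of d] y(2) shift_neg_shift[OF x(1)] by simp
  then show ?thesis
    using shift_hom[OF y(1), of d] shift_neg_shift_obj[OF w] by auto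
qed

text \<open>Two rotations place \<open>h\<close> and the negative of \<open>f[1]\<close> at the
  front of a distinguished triangle. Exactness at its middle object gives the claim, since a sign
  does not change a kernel.\<close>

lemma dist_kernel_shift:
  assumes "(f, g, h) \<in> Dist C" "f \<in> Hom C a b" "g \<in> Hom C b c" "h \<in> Hom C c (ShO C 1 a)"
    and y: "y \<in> Hom C w (ShO C d a)"
  shows "ShA C d f \<cdot> y = ZeroArr C w (ShO C d b) \<longleftrightarrow>
    (\<exists>z \<in> Hom C w (ShO C (d - 1) c). y = ShA C (d - 1) h \<cdot> z)"
proof -
  let ?k = "ShA C 1 f" and ?e = "d - 1"
  have a: "a \<in> Obj C" and b: "b \<in> Obj C" and w: "w \<in> Obj C"
    using assms hom_dom_obj hom_cod_obj by blast+
  have k: "?k \<in> Hom C (ShO C 1 a) (ShO C 1 b)"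
    using shift_hom[OF assms(2)] .
  \<comment> \<open>The rotated triangle already contains \<open>f[1]\<close>, so translating it by
    d - 1 produces \<open>f[d]\<close>; hence the degree d - 1 on the side of
    \<open>h\<close>.\<close>
  have k': "ShA C ?e (neg_arr C ?k) = neg_arr C (ShA C d f)"
    using shift_neg[OF k, of ?e] shift_shift[OF assms(2), of ?e 1] by simp
  have obj: "ShO C ?e (ShO C 1 a) = ShO C d a" "ShO C ?e (ShO C 1 b) = ShO C d b"
    using shift_add_obj a b by auto
  have f': "ShA C d f \<in> Hom C (ShO C d a) (ShO C d b)"
    using shift_hom[OF assms(2)] .
  have h': "ShA C ?e h \<in> Hom C (ShO C ?e c) (ShO C d a)"
    using shift_hom[OF assms(4), of ?e] obj by simp
  have T1: "(g, h, neg_arr C ?k) \<in> Dist C"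
    by (rule dist_rotate[OF assms(1)])
  have T2: "(h, neg_arr C ?k, neg_arr C (ShA C 1 g)) \<in> Dist C"
    by (rule dist_rotate[OF T1])
  show ?thesis
  proof
    assume "ShA C d f \<cdot> y = ZeroArr C w (ShO C d b)"
    then have "ShA C ?e (neg_arr C ?k) \<cdot> y = ZeroArr C w (ShO C ?e (ShO C 1 b))"
      using comp_neg_left[OF y f'] neg_zero[OF w shift_obj[OF b]] k' obj by simp
    then show "\<exists>z \<in> Hom C w (ShO C ?e c). y = ShA C ?e h \<cdot> z"
      using dist_lift_shift[OF T2 assms(4) neg_hom[OF k], of y w ?e] y obj by auto
  next
    assume "\<exists>z \<in> Hom C w (ShO C ?e c). y = ShA C ?e h \<cdot> z"
    then obtain z where z: "z \<in> Hom C w (ShO C ?e c)" "y = ShA C ?e h \<cdot> z"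
      by blast
    have "neg_arr C (ShA C d f) \<cdot> ShA C ?e h = ZeroArr C (ShO C ?e c) (ShO C d b)"
      using dist_comp_zero[OF T2 assms(4) neg_hom[OF k]] shift_comp[OF assms(4) neg_hom[OF k], of ?e]
        shift_zero[OF hom_cod_obj[OF assms(3)] shift_obj[OF b]] k' obj by simp
    then have "neg_arr C (ShA C d f \<cdot> ShA C ?e h) = neg_arr C (ZeroArr C (ShO C ?e c) (ShO C d b))"
      using comp_neg_left[OF h' f'] neg_zero[OF hom_dom_obj[OF h'] hom_cod_obj[OF f']] by simp
    then have "ShA C d f \<cdot> ShA C ?e h = ZeroArr C (ShO C ?e c) (ShO C d b)"
      by (rule neg_inj[OF comp_hom[OF h' f'] zero_hom[OF hom_dom_obj[OF h'] hom_cod_obj[OF f']]])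
    then show "ShA C d f \<cdot> y = ZeroArr C w (ShO C d b)"
      using comp_assoc[OF z(1) h' f'] comp_zero_left[OF z(1) hom_cod_obj[OF f']] z(2) by simp
  qed
qed

end


section \<open>Exact functors and adjunctions\<close>

locale exact_functor = source: triangulated_category C + target: triangulated_category E
  for C :: "('o, 'm, 'z) tri_cat_scheme" and E :: "('o, 'm, 'y) tri_cat_scheme" +
  fixes F :: "('o, 'm, 'x) exact_func_scheme"
  assumes exact: "is_exact_functor C E F"
begin

lemma functorial: "is_functor C E F"
  using exact by (simp add: is_exact_functor_def)

lemmas obj = functor_obj[OF functorial]
  and hom = functor_hom[OF functorial]
  and comp = functor_comp[OF functorial]

lemma additive:
  "\<lbrakk>f \<in> Hom C a b; g \<in> Hom C a b\<rbrakk> \<Longrightarrow> AMap F (f \<boxplus>\<^bsub>C\<^esub> g) = AMap F f \<boxplus>\<^bsub>E\<^esub> AMap F g"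
  using exact unfolding is_exact_functor_def by blast

lemma Xi_hom: "a \<in> Obj C \<Longrightarrow> Xi F a \<in> Hom E (OMap F (ShO C 1 a)) (ShO E 1 (OMap F a))"
  using exact by (simp add: is_exact_functor_def is_nat_trans_def comp_func_def shift_def)

lemma Xi_is_iso: "a \<in> Obj C \<Longrightarrow> is_iso E (Xi F a)"
  using exact by (simp add: is_exact_functor_def)

lemma shift_iso_nat:
  "a \<in> Obj C \<Longrightarrow>
    shift_iso_nat C E F n a \<in> Hom E (OMap F (ShO C (int n) a)) (ShO E (int n) (OMap F a)) \<and>
    is_iso E (shift_iso_nat C E F n a)"
proof (induction n arbitrary: a)
  case 0
  then have "Ident E (OMap F a) \<in> Hom E (OMap F a) (OMap F a)"
    using target.ident_hom obj by blast
  then show ?case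
    using 0 source.shift_0_obj target.shift_0_obj obj target.ident_left target.is_isoI by simp
next
  case (Suc n)
  have ob: "ShO C (int n) (ShO C 1 a) = ShO C (int (Suc n)) a"
      "ShO E (int n) (ShO E 1 (OMap F a)) = ShO E (int (Suc n)) (OMap F a)"
    using source.shift_add_obj[OF Suc.prems] target.shift_add_obj[OF obj[OF Suc.prems]]
    by (simp_all add: add.commute)
  have a1: "ShO C 1 a \<in> Obj C"
    using source.shift_obj[OF Suc.prems] .
  have 1: "shift_iso_nat C E F n (ShO C 1 a)
      \<in> Hom E (OMap F (ShO C (int (Suc n)) a)) (ShO E (int n) (OMap F (ShO C 1 a)))"
    using Suc.IH[OF a1] ob by simp
  have 2: "ShA E (int n) (Xi F a)
      \<in> Hom E (ShO E (int n) (OMap F (ShO C 1 a))) (ShO E (int (Suc n)) (OMap F a))"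
    using target.shift_hom[OF Xi_hom[OF Suc.prems], of "int n"] ob by simp
  have "is_iso E (ShA E (int n) (Xi F a))"
    using target.shift_is_iso[OF Xi_is_iso[OF Suc.prems] Xi_hom[OF Suc.prems]] .
  then show ?case
    using target.comp_hom[OF 1 2] target.is_iso_comp[OF _ 1 _ 2] Suc.IH[OF a1] by simp
qed

text \<open>Type and invertibility are what the later arguments take from these maps: they can be
  cancelled in \<open>restr\<close> and inverted in \<open>adjoint_class\<close>.\<close>

lemma shift_iso:
  assumes a: "a \<in> Obj C"
  shows "shift_iso C E F d a \<in> Hom E (OMap F (ShO C d a)) (ShO E d (OMap F a))"
    and "is_iso E (shift_iso C E F d a)"
proof -
  have "shift_iso C E F d a \<in> Hom E (OMap F (ShO C d a)) (ShO E d (OMap F a)) \<and>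
    is_iso E (shift_iso C E F d a)"
  proof (cases "0 \<le> d")
    case True
    then show ?thesis
      using shift_iso_nat[OF a, of "nat d"] by (simp add: shift_iso_def)
  next
    case False
    let ?s = "shift_iso_nat C E F (nat (- d)) (ShO C d a)"
    have "ShO C (- d) (ShO C d a) = a"
      using source.shift_neg_shift_obj[OF a, of "- d"] by simp
    then have s: "?s \<in> Hom E (OMap F a) (ShO E (- d) (OMap F (ShO C d a)))" "is_iso E ?s"
      using shift_iso_nat[OF source.shift_obj[OF a], of "nat (- d)" d] False by simp_all
    have "ShA E d ?s \<in> Hom E (ShO E d (OMap F a)) (OMap F (ShO C d a))"
      using target.shift_hom[OF s(1), of d]
        target.shift_neg_shift_obj[OF obj[OF source.shift_obj[OF a]], of d d] by simp
    moreover have "is_iso E (ShA E d ?s)"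
      using target.shift_is_iso[OF s(2,1)] .
    ultimately show ?thesis
      using target.inv_arr(1) target.is_iso_inv_arr False by (simp add: shift_iso_def)
  qed
  then show "shift_iso C E F d a \<in> Hom E (OMap F (ShO C d a)) (ShO E d (OMap F a))"
    and "is_iso E (shift_iso C E F d a)" by auto
qed

end

section \<open>Units of exact adjunctions under translation\<close>

locale exact_adjunction = source: triangulated_category C + target: triangulated_category E
  for C :: "('o, 'm, 'z) tri_cat_scheme" and E :: "('o, 'm, 'y) tri_cat_scheme" +
  fixes F :: "('o, 'm, 'x) exact_func_scheme" and G :: "('o, 'm, 'w) exact_func_scheme"
    and \<eta> \<epsilon> :: "'o \<Rightarrow> 'm"
  assumes exact_adjunction: "is_exact_adjunction C E F G \<eta> \<epsilon>"
begin

sublocale left: exact_functor C E F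
  using exact_adjunction by unfold_locales (simp add: is_exact_adjunction_def)

sublocale right: exact_functor E C G
  using exact_adjunction by unfold_locales (simp add: is_exact_adjunction_def)

lemma adjunction: "is_adjunction C E F G \<eta> \<epsilon>"
  using exact_adjunction by (simp add: is_exact_adjunction_def)

lemma unit_hom: "a \<in> Obj C \<Longrightarrow> \<eta> a \<in> Hom C a (OMap G (OMap F a))"
  using adjunction by (simp add: is_adjunction_def is_nat_trans_def comp_func_def id_func_def)

lemma unit_natural: "f \<in> Hom C a b \<Longrightarrow> AMap G (AMap F f) \<cdot>\<^bsub>C\<^esub> \<eta> a = \<eta> b \<cdot>\<^bsub>C\<^esub> f"
  using adjunction unfolding is_adjunction_def is_nat_trans_def comp_func_def id_func_def by simp

lemma counit_hom: "b \<in> Obj E \<Longrightarrow> \<epsilon> b \<in> Hom E (OMap F (OMap G b)) b"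
  using adjunction by (simp add: is_adjunction_def is_nat_trans_def comp_func_def id_func_def)

lemma triangle_identity:
  "b \<in> Obj E \<Longrightarrow> AMap G (\<epsilon> b) \<cdot>\<^bsub>C\<^esub> \<eta> (OMap G b) = Ident C (OMap G b)"
  using adjunction by (simp add: is_adjunction_def)

text \<open>The compatibility axiom reassociated, so that the two comparison maps form a single
  arrow applied to the unit.\<close>

lemma unit_Xi:
  "a \<in> Obj C \<Longrightarrow> (Xi G (OMap F a) \<cdot>\<^bsub>C\<^esub> AMap G (Xi F a)) \<cdot>\<^bsub>C\<^esub> \<eta> (ShO C 1 a) = ShA C 1 (\<eta> a)"
  using exact_adjunction source.comp_assoc[OF unit_hom right.hom[OF left.Xi_hom] right.Xi_hom]
    source.shift_obj left.obj by (simp add: is_exact_adjunction_def)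

text \<open>The witness is the usual transpose \<epsilon>(b) \<cdot> F(z); naturality of the unit
  and a triangle identity give the equation. This is the source of surjectivity of
  \<open>adjoint_class\<close>.\<close>

lemma transpose_surj:
  assumes "z \<in> Hom C a (OMap G b)" and b: "b \<in> Obj E"
  shows "\<exists>w \<in> Hom E (OMap F a) b. AMap G w \<cdot>\<^bsub>C\<^esub> \<eta> a = z"
proof
  have a: "a \<in> Obj C"
    using source.hom_dom_obj[OF assms(1)] .
  have Fz: "AMap F z \<in> Hom E (OMap F a) (OMap F (OMap G b))"
    using left.hom[OF assms(1)] .
  show "\<epsilon> b \<cdot>\<^bsub>E\<^esub> AMap F z \<in> Hom E (OMap F a) b"
    using target.comp_hom[OF Fz counit_hom[OF b]] .
  have "AMap G (\<epsilon> b \<cdot>\<^bsub>E\<^esub> AMap F z) \<cdot>\<^bsub>C\<^esub> \<eta> a = AMap G (\<epsilon> b) \<cdot>\<^bsub>C\<^esub> (AMap G (AMap F z) \<cdot>\<^bsub>C\<^esub> \<eta> a)"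
    using source.comp_assoc[OF unit_hom[OF a] right.hom[OF Fz] right.hom[OF counit_hom[OF b]]]
      right.comp[OF Fz counit_hom[OF b]] by simp
  also have "\<dots> = (AMap G (\<epsilon> b) \<cdot>\<^bsub>C\<^esub> \<eta> (OMap G b)) \<cdot>\<^bsub>C\<^esub> z"
    using source.comp_assoc[OF assms(1) unit_hom[OF right.obj[OF b]] right.hom[OF counit_hom[OF b]]]
      unit_natural[OF assms(1)] by simp
  also have "\<dots> = z"
    using triangle_identity[OF b] source.ident_left[OF assms(1)] by simp
  finally show "AMap G (\<epsilon> b \<cdot>\<^bsub>E\<^esub> AMap F z) \<cdot>\<^bsub>C\<^esub> \<eta> a = z" .
qed

text \<open>\<phi> is G applied to the comparison map of F, followed by that of G; both are
  invertible.\<close>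

lemma unit_shift_1:
  assumes a: "a \<in> Obj C"
  obtains \<phi> where "\<phi> \<in> Hom C (OMap G (OMap F (ShO C 1 a))) (ShO C 1 (OMap G (OMap F a)))"
    "is_iso C \<phi>" "\<phi> \<cdot>\<^bsub>C\<^esub> \<eta> (ShO C 1 a) = ShA C 1 (\<eta> a)"
proof -
  have h: "AMap G (Xi F a) \<in> Hom C (OMap G (OMap F (ShO C 1 a))) (OMap G (ShO E 1 (OMap F a)))"
    "Xi G (OMap F a) \<in> Hom C (OMap G (ShO E 1 (OMap F a))) (ShO C 1 (OMap G (OMap F a)))"
    using right.hom[OF left.Xi_hom[OF a]] right.Xi_hom[OF left.obj[OF a]] .
  have i: "is_iso C (AMap G (Xi F a))" "is_iso C (Xi G (OMap F a))"
    using target.functor_is_iso[OF right.functorial source.category_axioms left.Xi_is_iso[OF a] left.Xi_hom[OF a]]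
      right.Xi_is_iso[OF left.obj[OF a]] .
  show thesis
    using that[OF source.comp_hom[OF h] source.is_iso_comp[OF i(1) h(1) i(2) h(2)] unit_Xi[OF a]] .
qed

text \<open>The compatibility of the unit with translation by 1 propagates to all translations,
  upwards by composing and downwards by inverting.\<close>

lemma unit_shift:
  assumes a: "a \<in> Obj C"
  shows "\<exists>\<phi> \<in> Hom C (OMap G (OMap F (ShO C d a))) (ShO C d (OMap G (OMap F a))).
    is_iso C \<phi> \<and> \<phi> \<cdot>\<^bsub>C\<^esub> \<eta> (ShO C d a) = ShA C d (\<eta> a)"
proof (induction d rule: int_induct[where k = 0])
  case base
  have "OMap G (OMap F a) \<in> Obj C"
    using right.obj left.obj a by blast
  then have "Ident C (OMap G (OMap F a)) \<in> Hom C (OMap G (OMap F a)) (OMap G (OMap F a))"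
    "is_iso C (Ident C (OMap G (OMap F a)))"
    "ShO C 0 (OMap G (OMap F a)) = OMap G (OMap F a)"
    using source.ident_hom source.ident_left source.is_isoI source.shift_0_obj by metis+
  then show ?case
    using source.ident_left[OF unit_hom[OF a]] source.shift_0_obj[OF a] source.shift_0_arr unit_hom[OF a]
    by (auto simp: Hom_def)
next
  case (step1 d)
  then obtain \<phi> where \<phi>: "\<phi> \<in> Hom C (OMap G (OMap F (ShO C d a))) (ShO C d (OMap G (OMap F a)))"
    "is_iso C \<phi>" "\<phi> \<cdot>\<^bsub>C\<^esub> \<eta> (ShO C d a) = ShA C d (\<eta> a)" by blast
  have ad: "ShO C d a \<in> Obj C" and Ga: "OMap G (OMap F a) \<in> Obj C"
    using source.shift_obj a right.obj left.obj by blast+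
  have ob: "ShO C 1 (ShO C d a) = ShO C (d + 1) a"
    "ShO C 1 (ShO C d (OMap G (OMap F a))) = ShO C (d + 1) (OMap G (OMap F a))"
    using source.shift_add_obj a Ga by (simp_all add: add.commute)
  obtain \<psi> where \<psi>: "\<psi> \<in> Hom C (OMap G (OMap F (ShO C (d + 1) a))) (ShO C 1 (OMap G (OMap F (ShO C d a))))"
    "is_iso C \<psi>" "\<psi> \<cdot>\<^bsub>C\<^esub> \<eta> (ShO C (d + 1) a) = ShA C 1 (\<eta> (ShO C d a))"
    using unit_shift_1[OF ad] ob by metis
  have \<phi>1: "ShA C 1 \<phi> \<in> Hom C (ShO C 1 (OMap G (OMap F (ShO C d a)))) (ShO C (d + 1) (OMap G (OMap F a)))"
    using source.shift_hom[OF \<phi>(1), of 1] ob by simp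
  have "(ShA C 1 \<phi> \<cdot>\<^bsub>C\<^esub> \<psi>) \<cdot>\<^bsub>C\<^esub> \<eta> (ShO C (d + 1) a) = ShA C 1 \<phi> \<cdot>\<^bsub>C\<^esub> ShA C 1 (\<eta> (ShO C d a))"
    using source.comp_assoc[OF unit_hom[OF source.shift_obj[OF a]] \<psi>(1) \<phi>1] \<psi>(3) by simp
  also have "\<dots> = ShA C 1 (ShA C d (\<eta> a))"
    using source.shift_comp[OF unit_hom[OF ad] \<phi>(1)] \<phi>(3) by simp
  also have "\<dots> = ShA C (d + 1) (\<eta> a)"
    using source.shift_shift[OF unit_hom[OF a]] by (simp add: add.commute)
  finally show ?case
    using source.comp_hom[OF \<psi>(1) \<phi>1]
      source.is_iso_comp[OF \<psi>(2,1) source.shift_is_iso[OF \<phi>(2,1)] \<phi>1] by blast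
next
  case (step2 d)
  then obtain \<phi> where \<phi>: "\<phi> \<in> Hom C (OMap G (OMap F (ShO C d a))) (ShO C d (OMap G (OMap F a)))"
    "is_iso C \<phi>" "\<phi> \<cdot>\<^bsub>C\<^esub> \<eta> (ShO C d a) = ShA C d (\<eta> a)" by blast
  let ?e = "d - 1"
  have ae: "ShO C ?e a \<in> Obj C" and Ga: "OMap G (OMap F a) \<in> Obj C"
    using source.shift_obj a right.obj left.obj by blast+
  have Gae: "OMap G (OMap F (ShO C ?e a)) \<in> Obj C"
    using ae right.obj left.obj by blast
  have ob: "ShO C 1 (ShO C ?e a) = ShO C d a"
    "ShO C (-1) (ShO C d (OMap G (OMap F a))) = ShO C ?e (OMap G (OMap F a))"
    "ShO C (-1) (ShO C 1 (OMap G (OMap F (ShO C ?e a)))) = OMap G (OMap F (ShO C ?e a))"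
    using source.shift_add_obj[OF a] source.shift_add_obj[OF Ga] source.shift_add_obj[OF Gae]
      source.shift_0_obj[OF Gae] by simp_all
  obtain \<psi> where \<psi>: "\<psi> \<in> Hom C (OMap G (OMap F (ShO C d a))) (ShO C 1 (OMap G (OMap F (ShO C ?e a))))"
    "is_iso C \<psi>" "\<psi> \<cdot>\<^bsub>C\<^esub> \<eta> (ShO C d a) = ShA C 1 (\<eta> (ShO C ?e a))"
    using unit_shift_1[OF ae] ob by metis
  \<comment> \<open>Since a[d] is the translate of a[d - 1], \<psi> carries \<eta>(a[d]) to
    \<eta>(a[d - 1])[1]. Undoing \<psi> and then applying \<phi> carries the latter to \<eta>(a)[d];
    translating by -1 yields the comparison in degree d - 1.\<close>
  let ?\<theta> = "\<phi> \<cdot>\<^bsub>C\<^esub> inv_arr C \<psi>"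
  note \<psi>' = source.inv_arr(1)[OF \<psi>(2,1)]
  have \<theta>: "?\<theta> \<in> Hom C (ShO C 1 (OMap G (OMap F (ShO C ?e a)))) (ShO C d (OMap G (OMap F a)))"
    using source.comp_hom[OF \<psi>' \<phi>(1)] .
  have \<theta>i: "is_iso C ?\<theta>"
    using source.is_iso_comp[OF source.is_iso_inv_arr[OF \<psi>(2,1)] \<psi>' \<phi>(2,1)] .
  have u: "ShA C 1 (\<eta> (ShO C ?e a)) \<in> Hom C (ShO C d a) (ShO C 1 (OMap G (OMap F (ShO C ?e a))))"
    using source.shift_hom[OF unit_hom[OF ae], of 1] ob by simp
  have "?\<theta> \<cdot>\<^bsub>C\<^esub> ShA C 1 (\<eta> (ShO C ?e a)) = \<phi> \<cdot>\<^bsub>C\<^esub> (inv_arr C \<psi> \<cdot>\<^bsub>C\<^esub> (\<psi> \<cdot>\<^bsub>C\<^esub> \<eta> (ShO C d a)))"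
    using source.comp_assoc[OF u \<psi>' \<phi>(1)] \<psi>(3) by simp
  also have "\<dots> = ShA C d (\<eta> a)"
    using source.inv_arr_cancel_left[OF \<psi>(2,1) unit_hom[OF source.shift_obj[OF a]]] \<phi>(3) by simp
  finally have "ShA C (-1) (?\<theta> \<cdot>\<^bsub>C\<^esub> ShA C 1 (\<eta> (ShO C ?e a))) = ShA C ?e (\<eta> a)"
    using source.shift_shift[OF unit_hom[OF a], of "-1" d] by simp
  then have "ShA C (-1) ?\<theta> \<cdot>\<^bsub>C\<^esub> \<eta> (ShO C ?e a) = ShA C ?e (\<eta> a)"
    using source.shift_comp[OF u \<theta>, of "-1"] source.shift_neg_shift[OF unit_hom[OF ae], of "-1"] by simp
  moreover have "ShA C (-1) ?\<theta> \<in> Hom C (OMap G (OMap F (ShO C ?e a))) (ShO C ?e (OMap G (OMap F a)))"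
    using source.shift_hom[OF \<theta>, of "-1"] ob by simp
  ultimately show ?case
    using source.shift_is_iso[OF \<theta>i \<theta>] by blast
qed

text \<open>By \<open>unit_shift\<close> and naturality, \<eta>(a)[d] \<cdot> z = \<phi> \<cdot>
  GF(z) \<cdot> \<eta>(w), which depends on z only through F(z).\<close>

lemma unit_shift_eqI:
  assumes a: "a \<in> Obj C" and x: "x \<in> Hom C w (ShO C d a)" and y: "y \<in> Hom C w (ShO C d a)"
    and eq: "AMap F x = AMap F y"
  shows "ShA C d (\<eta> a) \<cdot>\<^bsub>C\<^esub> x = ShA C d (\<eta> a) \<cdot>\<^bsub>C\<^esub> y"
proof -
  obtain \<phi> where \<phi>: "\<phi> \<in> Hom C (OMap G (OMap F (ShO C d a))) (ShO C d (OMap G (OMap F a)))"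
    "\<phi> \<cdot>\<^bsub>C\<^esub> \<eta> (ShO C d a) = ShA C d (\<eta> a)"
    using unit_shift[OF a] by blast
  note u = unit_hom[OF source.shift_obj[OF a, of d]]
  have "ShA C d (\<eta> a) \<cdot>\<^bsub>C\<^esub> z = \<phi> \<cdot>\<^bsub>C\<^esub> (AMap G (AMap F z) \<cdot>\<^bsub>C\<^esub> \<eta> w)" if "z \<in> Hom C w (ShO C d a)" for z
    using source.comp_assoc[OF that u \<phi>(1)] unit_natural[OF that] \<phi>(2) by simp
  then show ?thesis
    using x y eq by simp
qed

end


section \<open>Direct sums of homomorphisms\<close>

text \<open>The reindexing \<sigma> is there for \<open>graded_delta\<close>, whose component in
  degree d reads degree d - 1. Homomorphisms preserve units, so finite support survives; the
  converse inclusion needs preimages that are chosen with finite support.\<close>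

lemma sum_group_map_image:
  assumes \<sigma>: "bij_betw \<sigma> I J"
    and G: "\<And>j. j \<in> J \<Longrightarrow> group (G j)" and H: "\<And>i. i \<in> I \<Longrightarrow> group (H i)"
    and f: "\<And>i. i \<in> I \<Longrightarrow> f i \<in> hom (G (\<sigma> i)) (H i)"
  shows "(\<lambda>x. \<lambda>i\<in>I. f i (x (\<sigma> i))) ` carrier (sum_group J G) =
    {y \<in> carrier (sum_group I H). \<forall>i\<in>I. y i \<in> f i ` carrier (G (\<sigma> i))}"
proof -
  note carrier = carrier_sum_group[of J G, OF G] carrier_sum_group[of I H, OF H]
  have \<sigma>J: "\<sigma> i \<in> J" if "i \<in> I" for i
    using \<sigma> that by (auto simp: bij_betw_def)
  have one: "f i \<one>\<^bsub>G (\<sigma> i)\<^esub> = \<one>\<^bsub>H i\<^esub>" if "i \<in> I" for i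
    using hom_one[OF f G H] that \<sigma>J by blast
  show ?thesis
  proof (intro equalityI subsetI)
    fix y assume "y \<in> (\<lambda>x. \<lambda>i\<in>I. f i (x (\<sigma> i))) ` carrier (sum_group J G)"
    then obtain x where x: "x \<in> (\<Pi>\<^sub>E j\<in>J. carrier (G j))" "finite {j \<in> J. x j \<noteq> \<one>\<^bsub>G j\<^esub>}"
      and y: "y = (\<lambda>i\<in>I. f i (x (\<sigma> i)))"
      using carrier by auto
    have "finite {i \<in> I. x (\<sigma> i) \<noteq> \<one>\<^bsub>G (\<sigma> i)\<^esub>}"
    proof (rule finite_imageD)
      show "finite (\<sigma> ` {i \<in> I. x (\<sigma> i) \<noteq> \<one>\<^bsub>G (\<sigma> i)\<^esub>})"
        by (rule finite_subset[OF _ x(2)]) (use \<sigma>J in auto)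
      show "inj_on \<sigma> {i \<in> I. x (\<sigma> i) \<noteq> \<one>\<^bsub>G (\<sigma> i)\<^esub>}"
        using \<sigma> by (auto simp: bij_betw_def inj_on_def)
    qed
    then have "finite {i \<in> I. y i \<noteq> \<one>\<^bsub>H i\<^esub>}"
      by (rule rev_finite_subset) (use y one in auto)
    moreover have xc: "x (\<sigma> i) \<in> carrier (G (\<sigma> i))" if "i \<in> I" for i
      using x(1) \<sigma>J[OF that] by auto
    then have "y \<in> (\<Pi>\<^sub>E i\<in>I. carrier (H i))"
      using y hom_in_carrier[OF f] by auto
    ultimately show "y \<in> {y \<in> carrier (sum_group I H). \<forall>i\<in>I. y i \<in> f i ` carrier (G (\<sigma> i))}"
      using carrier y xc by auto
  next
    fix y assume "y \<in> {y \<in> carrier (sum_group I H). \<forall>i\<in>I. y i \<in> f i ` carrier (G (\<sigma> i))}"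
    then have y: "y \<in> (\<Pi>\<^sub>E i\<in>I. carrier (H i))" "finite {i \<in> I. y i \<noteq> \<one>\<^bsub>H i\<^esub>}"
      and im: "\<forall>i\<in>I. y i \<in> f i ` carrier (G (\<sigma> i))"
      using carrier by auto
    from im have "\<forall>i\<in>I. \<exists>x. x \<in> carrier (G (\<sigma> i)) \<and> f i x = y i"
      by (metis imageE)
    then obtain g where g: "\<And>i. i \<in> I \<Longrightarrow> g i \<in> carrier (G (\<sigma> i))" "\<And>i. i \<in> I \<Longrightarrow> f i (g i) = y i"
      by metis
    \<comment> \<open>Over a unit component the unit is chosen instead of an arbitrary preimage;
      otherwise the chosen family could have infinite support.\<close>
    define h where "h i = (if y i = \<one>\<^bsub>H i\<^esub> then \<one>\<^bsub>G (\<sigma> i)\<^esub> else g i)" for i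
    have h: "h i \<in> carrier (G (\<sigma> i))" "f i (h i) = y i" if "i \<in> I" for i
      using g[OF that] one[OF that] monoid.one_closed[OF group.is_monoid[OF G[OF \<sigma>J[OF that]]]]
      by (auto simp: h_def)
    define x where "x = (\<lambda>j\<in>J. h (inv_into I \<sigma> j))"
    have inv: "inv_into I \<sigma> j \<in> I" "\<sigma> (inv_into I \<sigma> j) = j" if "j \<in> J" for j
      using \<sigma> that by (auto simp: bij_betw_def inv_into_into f_inv_into_f)
    have "{j \<in> J. x j \<noteq> \<one>\<^bsub>G j\<^esub>} \<subseteq> \<sigma> ` {i \<in> I. y i \<noteq> \<one>\<^bsub>H i\<^esub>}"
    proof
      fix j assume "j \<in> {j \<in> J. x j \<noteq> \<one>\<^bsub>G j\<^esub>}"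
      then have j: "j \<in> J" "h (inv_into I \<sigma> j) \<noteq> \<one>\<^bsub>G j\<^esub>"
        by (auto simp: x_def)
      then have "y (inv_into I \<sigma> j) \<noteq> \<one>\<^bsub>H (inv_into I \<sigma> j)\<^esub>"
        using inv(2)[OF j(1)] by (auto simp: h_def)
      then show "j \<in> \<sigma> ` {i \<in> I. y i \<noteq> \<one>\<^bsub>H i\<^esub>}"
        using inv[OF j(1)] by (metis (mono_tags, lifting) image_eqI mem_Collect_eq)
    qed
    then have "finite {j \<in> J. x j \<noteq> \<one>\<^bsub>G j\<^esub>}"
      using y(2) finite_subset by blast
    moreover have "x \<in> (\<Pi>\<^sub>E j\<in>J. carrier (G j))"
      unfolding x_def using h(1)[OF inv(1)] inv(2) by (auto simp: PiE_iff)
    ultimately have "x \<in> carrier (sum_group J G)"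
      using carrier by simp
    moreover have "y = (\<lambda>i\<in>I. f i (x (\<sigma> i)))"
    proof
      fix i
      have "inv_into I \<sigma> (\<sigma> i) = i" if "i \<in> I"
        using \<sigma> that by (simp add: bij_betw_def)
      then show "y i = (\<lambda>i\<in>I. f i (x (\<sigma> i))) i"
        using y(1) h(2)[of i] \<sigma>J[of i] by (auto simp: x_def PiE_iff extensional_def)
    qed
    ultimately show "y \<in> (\<lambda>x. \<lambda>i\<in>I. f i (x (\<sigma> i))) ` carrier (sum_group J G)"
      by blast
  qed
qed

lemma sum_group_map_hom:
  assumes G: "\<And>i. i \<in> I \<Longrightarrow> group (G i)" and H: "\<And>i. i \<in> I \<Longrightarrow> group (H i)"
    and f: "\<And>i. i \<in> I \<Longrightarrow> f i \<in> hom (G i) (H i)"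
  shows "group_hom (sum_group I G) (sum_group I H) (\<lambda>x. \<lambda>i\<in>I. f i (x i))"
proof -
  have "(\<lambda>x. \<lambda>i\<in>I. f i (x i)) \<in> hom (sum_group I G) (sum_group I H)"
  proof (rule homI)
    fix x assume "x \<in> carrier (sum_group I G)"
    \<comment> \<open>Closure, finite support included, is the image description with the identity
      as reindexing.\<close>
    then show "(\<lambda>i\<in>I. f i (x i)) \<in> carrier (sum_group I H)"
      using sum_group_map_image[of "\<lambda>i. i" I I G H f] assms by (auto simp: bij_betw_def)
  next
    fix x y assume "x \<in> carrier (sum_group I G)" "y \<in> carrier (sum_group I G)"
    then have "x i \<in> carrier (G i)" "y i \<in> carrier (G i)" if "i \<in> I" for i
      using that by (auto simp: carrier_sum_group[OF G])
    then show "(\<lambda>i\<in>I. f i ((x \<otimes>\<^bsub>sum_group I G\<^esub> y) i)) =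
        (\<lambda>i\<in>I. f i (x i)) \<otimes>\<^bsub>sum_group I H\<^esub> (\<lambda>i\<in>I. f i (y i))"
      using hom_mult[OF f] by (auto intro!: restrict_ext)
  qed
  then show ?thesis
    using assms by (simp add: group_hom_def group_hom_axioms_def)
qed

text \<open>Multiplying x by a kernel element stays in its fibre, so uniqueness forces that element
  to be the unit; conversely a trivial kernel gives injectivity.\<close>

lemma group_hom_fibre_unique_iff:
  assumes "group_hom G H h" "x \<in> carrier G"
  shows "(\<exists>!y. y \<in> carrier G \<and> h y = h x) \<longleftrightarrow> kernel G H h = {\<one>\<^bsub>G\<^esub>}"
proof -
  interpret group_hom G H h by fact
  show ?thesis
  proof
    assume u: "\<exists>!y. y \<in> carrier G \<and> h y = h x"
    show "kernel G H h = {\<one>\<^bsub>G\<^esub>}"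
    proof (intro equalityI subsetI)
      fix k assume "k \<in> kernel G H h"
      then have k: "k \<in> carrier G" "h k = \<one>\<^bsub>H\<^esub>"
        by (auto simp: kernel_def)
      then have "k \<otimes>\<^bsub>G\<^esub> x \<in> carrier G \<and> h (k \<otimes>\<^bsub>G\<^esub> x) = h x"
        using assms(2) by simp
      then have "k \<otimes>\<^bsub>G\<^esub> x = x"
        using u assms(2) by blast
      then show "k \<in> {\<one>\<^bsub>G\<^esub>}"
        using G.r_cancel_one[OF assms(2) k(1)] by simp
    qed (simp add: kernel_def)
  next
    assume "kernel G H h = {\<one>\<^bsub>G\<^esub>}"
    then show "\<exists>!y. y \<in> carrier G \<and> h y = h x"
      using assms(2) inj_on_one_iff by (auto simp: kernel_def inj_on_def)
  qed
qed


section \<open>The localisation sequence\<close>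

locale open_immersion_system = coefficient_system K
  for K :: "('s, 'f, 'p, 'o, 'm) coeff_sys" +
  fixes j :: 'f
  assumes open_imm: "j \<in> OpenImm (Spaces K)"
begin

abbreviation "CX \<equiv> Coef K (Cod (Spaces K) j)"
abbreviation "CU \<equiv> Coef K (Dom (Spaces K) j)"

lemma j_arr: "j \<in> Arr (Spaces K)"
  using space_category.open_imm[OF spaces open_imm] by blast

lemma j_objs: "Cod (Spaces K) j \<in> Obj (Spaces K)" "Dom (Spaces K) j \<in> Obj (Spaces K)"
  using category.dom_obj category.cod_obj j_arr spaces by (auto simp: space_category_def)

lemma j_hom: "j \<in> Hom (Spaces K) (Dom (Spaces K) j) (Cod (Spaces K) j)"
  using j_arr by (simp add: Hom_def)

sublocale adj: exact_adjunction CX CU "Pull K j" "Push K j" "PUnit K j" "PCounit K j"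
  using pull_push[OF j_hom] coef_triangulated j_objs
  by (simp add: exact_adjunction_def exact_adjunction_axioms_def)

abbreviation "pull \<equiv> OMap (Pull K j)"
abbreviation "push \<equiv> OMap (Push K j)"

lemma one_obj: "One CX \<in> Obj CX" "One CU \<in> Obj CU"
  using symmetric_monoidal_category.one_obj coef_monoidal j_objs by blast+

lemma MuUnit: "MuUnit (Pull K j) \<in> Hom CU (One CU) (pull (One CX))" "is_iso CU (MuUnit (Pull K j))"
  using pull_monoidal[OF j_hom] by (auto simp: is_symmetric_monoidal_functor_def)

lemma coh_group_is_group: "A \<in> Obj CX \<Longrightarrow> group (coh_group CX A d)"
  "B \<in> Obj CU \<Longrightarrow> group (coh_group CU B d)"
  using adj.source.hom_group_is_group adj.source.shift_obj
    adj.target.hom_group_is_group adj.target.shift_obj one_obj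
  by (auto simp: coh_group_def)

text \<open>Cancelling the shift comparison on the left and \<open>MuUnit\<close> on the right
  leaves equality of the pulled back arrows, which determines composition with the translated
  unit.\<close>

lemma restr_eqD:
  assumes A: "A \<in> Obj CX"
    and x: "x \<in> carrier (coh_group CX A d)" and y: "y \<in> carrier (coh_group CX A d)"
    and eq: "restr K j A d x = restr K j A d y"
  shows "ShA CX d (PUnit K j A) \<cdot>\<^bsub>CX\<^esub> x = ShA CX d (PUnit K j A) \<cdot>\<^bsub>CX\<^esub> y"
proof -
  note s = adj.left.shift_iso[OF A, of d]
  have xy: "x \<in> Hom CX (One CX) (ShO CX d A)" "y \<in> Hom CX (One CX) (ShO CX d A)"
    using x y by (simp_all add: coh_group_def)
  note Fx = adj.left.hom[OF xy(1)] and Fy = adj.left.hom[OF xy(2)]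
  have "AMap (Pull K j) x \<cdot>\<^bsub>CU\<^esub> MuUnit (Pull K j) = AMap (Pull K j) y \<cdot>\<^bsub>CU\<^esub> MuUnit (Pull K j)"
    using adj.target.iso_cancel_left[OF s(2,1) adj.target.comp_hom[OF MuUnit(1) Fx]
        adj.target.comp_hom[OF MuUnit(1) Fy]] eq
    by (simp add: restr_def Let_def)
  then have "AMap (Pull K j) x = AMap (Pull K j) y"
    by (rule adj.target.iso_cancel_right[OF MuUnit(2,1) Fx Fy])
  then show ?thesis
    by (rule adj.unit_shift_eqI[OF A xy])
qed

lemma adjoint_class_hom:
  assumes A: "A \<in> Obj CX"
  shows "adjoint_class K j A d \<in> hom (coh_group CU (pull A) d) (coh_group CX (push (pull A)) d)"
proof -
  let ?B = "ShO CU d (pull A)"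
  have B: "?B \<in> Obj CU"
    using adj.left.obj[OF A] adj.target.shift_obj by blast
  note m = adj.target.inv_arr(1)[OF MuUnit(2,1)]
  have "(\<lambda>y. y \<cdot>\<^bsub>CU\<^esub> inv_arr CU (MuUnit (Pull K j)))
      \<in> hom (hom_group CU (One CU) ?B) (hom_group CU (pull (One CX)) ?B)"
    using group_hom.homh[OF adj.target.precomp_group_hom[OF m B]] .
  moreover have "AMap (Push K j)
      \<in> hom (hom_group CU (pull (One CX)) ?B) (hom_group CX (push (pull (One CX))) (push ?B))"
    using adj.right.hom adj.right.additive by (auto simp: hom_def)
  moreover have "(\<lambda>z. z \<cdot>\<^bsub>CX\<^esub> PUnit K j (One CX))
      \<in> hom (hom_group CX (push (pull (One CX))) (push ?B)) (hom_group CX (One CX) (push ?B))"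
    using group_hom.homh[OF adj.source.precomp_group_hom[OF adj.unit_hom[OF one_obj(1)] adj.right.obj[OF B]]] .
  moreover have "(\<lambda>z. shift_iso CU CX (Push K j) d (pull A) \<cdot>\<^bsub>CX\<^esub> z)
      \<in> hom (hom_group CX (One CX) (push ?B)) (coh_group CX (push (pull A)) d)"
    using group_hom.homh[OF adj.source.postcomp_group_hom[OF adj.right.shift_iso(1)[OF adj.left.obj[OF A]] one_obj(1)]]
    by (simp add: coh_group_def)
  ultimately have "(\<lambda>z. shift_iso CU CX (Push K j) d (pull A) \<cdot>\<^bsub>CX\<^esub> z) \<circ> ((\<lambda>z. z \<cdot>\<^bsub>CX\<^esub> PUnit K j (One CX))
      \<circ> (AMap (Push K j) \<circ> (\<lambda>y. y \<cdot>\<^bsub>CU\<^esub> inv_arr CU (MuUnit (Pull K j)))))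
    \<in> hom (hom_group CU (One CU) ?B) (coh_group CX (push (pull A)) d)"
    by (intro hom_compose)
  then show ?thesis
    by (simp add: adjoint_class_def[abs_def] Let_def o_def coh_group_def)
qed

text \<open>A preimage is built by undoing the shift comparison, transposing along the adjunction,
  and composing with \<open>MuUnit\<close> to absorb the inverse in
  \<open>adjoint_class\<close>.\<close>

lemma adjoint_class_surj:
  assumes A: "A \<in> Obj CX" and z: "z \<in> carrier (coh_group CX (push (pull A)) d)"
  shows "z \<in> adjoint_class K j A d ` carrier (coh_group CU (pull A) d)"
proof -
  let ?B = "ShO CU d (pull A)" and ?s = "shift_iso CU CX (Push K j) d (pull A)"
  have B: "?B \<in> Obj CU"
    using adj.left.obj[OF A] adj.target.shift_obj by blast
  note s = adj.right.shift_iso[OF adj.left.obj[OF A], of d]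
  have z': "z \<in> Hom CX (One CX) (ShO CX d (push (pull A)))"
    using z by (simp add: coh_group_def)
  obtain w where w: "w \<in> Hom CU (pull (One CX)) ?B"
    "AMap (Push K j) w \<cdot>\<^bsub>CX\<^esub> PUnit K j (One CX) = inv_arr CX ?s \<cdot>\<^bsub>CX\<^esub> z"
    using adj.transpose_surj[OF adj.source.comp_hom[OF z' adj.source.inv_arr(1)[OF s(2,1)]] B] by blast
  let ?y = "w \<cdot>\<^bsub>CU\<^esub> MuUnit (Pull K j)"
  have "?y \<cdot>\<^bsub>CU\<^esub> inv_arr CU (MuUnit (Pull K j)) = w"
    by (rule adj.target.inv_arr_cancel_right[OF MuUnit(2,1) w(1)])
  then have "adjoint_class K j A d ?y = ?s \<cdot>\<^bsub>CX\<^esub> (inv_arr CX ?s \<cdot>\<^bsub>CX\<^esub> z)"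
    using w(2) by (simp add: adjoint_class_def Let_def)
  also have "\<dots> = z"
    by (rule adj.source.inv_arr_cancel_left'[OF s(2,1) z'])
  finally show ?thesis
    using adj.target.comp_hom[OF MuUnit(1) w(1)] by (auto simp: coh_group_def intro!: rev_image_eqI)
qed

end

text \<open>This collects what the recollement contributes at the fixed object A.
  \<open>cod_i\<close> reconciles the supported groups, indexed by the target of i, with the
  restriction maps, indexed by that of j.\<close>

locale localisation_triangle = open_immersion_system K j
  for K :: "('s, 'f, 'p, 'o, 'm) coeff_sys" and j +
  fixes i :: 'f and R :: "('o, 'm) recoll" and A :: 'o
  assumes cod_i: "Cod (Spaces K) i = Cod (Spaces K) j"
    and A: "A \<in> Obj CX"
    and triangle: "(USCounit R A, PUnit K j A, UpperBd R A) \<in> Dist CX"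
    and counit_hom: "USCounit R A \<in> Hom CX (supp_obj K i R A) A"
begin

lemma boundary_hom: "UpperBd R A \<in> Hom CX (push (pull A)) (ShO CX 1 (supp_obj K i R A))"
  using adj.source.dist_triangle[OF triangle] counit_hom adj.unit_hom[OF A]
  by (auto simp: is_triangle_def Hom_def)

lemma supp_obj: "supp_obj K i R A \<in> Obj CX"
  using adj.source.hom_dom_obj[OF counit_hom] .

lemma supp_coh_group: "supp_coh_group K i R A d = hom_group CX (One CX) (ShO CX d (supp_obj K i R A))"
  by (simp add: supp_coh_group_def coh_group_def cod_i)

lemma supp_coh_group_is_group: "group (supp_coh_group K i R A d)"
  using coh_group_is_group(1)[OF supp_obj] by (simp add: supp_coh_group_def cod_i)

lemma forg_hom: "forg K i R A d \<in> hom (supp_coh_group K i R A d) (coh_group CX A d)"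
  using group_hom.homh[OF adj.source.postcomp_group_hom[OF adj.source.shift_hom[OF counit_hom] one_obj(1)]]
  by (simp add: forg_def[abs_def] Let_def cod_i supp_coh_group coh_group_def)

text \<open>Indexing by the target degree d matches \<open>graded_delta\<close> and leaves no (d -
  1) + 1 in the type.\<close>

lemma delta_hom:
  "delta K j R A (d - 1) \<in> hom (coh_group CU (pull A) (d - 1)) (supp_coh_group K i R A d)"
proof -
  have "ShA CX (d - 1) (UpperBd R A)
      \<in> Hom CX (ShO CX (d - 1) (push (pull A))) (ShO CX d (supp_obj K i R A))"
    using adj.source.shift_hom[OF boundary_hom, of "d - 1"] adj.source.shift_add_obj[OF supp_obj] by simp
  then have "(\<lambda>z. ShA CX (d - 1) (UpperBd R A) \<cdot>\<^bsub>CX\<^esub> z)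
      \<in> hom (coh_group CX (push (pull A)) (d - 1)) (supp_coh_group K i R A d)"
    using group_hom.homh[OF adj.source.postcomp_group_hom[OF _ one_obj(1)]]
    by (simp add: supp_coh_group coh_group_def)
  from hom_compose[OF adjoint_class_hom[OF A] this] show ?thesis
    by (simp add: delta_def[abs_def] Let_def o_def)
qed

text \<open>The triangle describes the kernel by arrows into the pushforward of the pullback of A;
  surjectivity of \<open>adjoint_class\<close> replaces them by classes on U.\<close>

lemma forg_kernel:
  assumes "x \<in> carrier (supp_coh_group K i R A d)"
  shows "forg K i R A d x = \<one>\<^bsub>coh_group CX A d\<^esub> \<longleftrightarrow>
    x \<in> delta K j R A (d - 1) ` carrier (coh_group CU (pull A) (d - 1))"
proof -
  have x: "x \<in> Hom CX (One CX) (ShO CX d (supp_obj K i R A))"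
    using assms by (simp add: supp_coh_group)
  have "forg K i R A d x = \<one>\<^bsub>coh_group CX A d\<^esub> \<longleftrightarrow>
    (\<exists>z \<in> carrier (coh_group CX (push (pull A)) (d - 1)). x = ShA CX (d - 1) (UpperBd R A) \<cdot>\<^bsub>CX\<^esub> z)"
    using adj.source.dist_kernel_shift[OF triangle counit_hom adj.unit_hom[OF A] boundary_hom x]
    by (simp add: forg_def Let_def cod_i coh_group_def)
  also have "carrier (coh_group CX (push (pull A)) (d - 1)) =
      adjoint_class K j A (d - 1) ` carrier (coh_group CU (pull A) (d - 1))"
    using adjoint_class_surj[OF A] hom_in_carrier[OF adjoint_class_hom[OF A]] by blast
  finally show ?thesis
    by (auto simp: delta_def Let_def)
qed

text \<open>Composition with the translated unit is a homomorphism taking equal values on x and y,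
  so it kills their difference, which then lifts along the counit.\<close>

lemma forg_image:
  assumes x: "x \<in> carrier (coh_group CX A d)" and y: "y \<in> carrier (coh_group CX A d)"
    and eq: "restr K j A d x = restr K j A d y"
  shows "x \<otimes>\<^bsub>coh_group CX A d\<^esub> inv\<^bsub>coh_group CX A d\<^esub> y
    \<in> forg K i R A d ` carrier (supp_coh_group K i R A d)"
proof -
  let ?H = "coh_group CX A d" and ?J = "coh_group CX (push (pull A)) d"
  interpret group_hom ?H ?J "\<lambda>x. ShA CX d (PUnit K j A) \<cdot>\<^bsub>CX\<^esub> x"
    using adj.source.postcomp_group_hom[OF adj.source.shift_hom[OF adj.unit_hom[OF A]] one_obj(1)]
    by (simp add: coh_group_def)
  let ?x = "x \<otimes>\<^bsub>?H\<^esub> inv\<^bsub>?H\<^esub> y"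
  have "ShA CX d (PUnit K j A) \<cdot>\<^bsub>CX\<^esub> ?x = \<one>\<^bsub>?J\<^esub>"
    using x y restr_eqD[OF A x y eq] by simp
  moreover have "?x \<in> Hom CX (One CX) (ShO CX d A)"
    using x y G.m_closed[OF x G.inv_closed[OF y]] by (simp add: coh_group_def)
  ultimately show ?thesis
    using adj.source.dist_lift_shift[OF triangle counit_hom adj.unit_hom[OF A], of ?x "One CX" d]
    unfolding image_iff by (simp add: forg_def Let_def cod_i supp_coh_group coh_group_def) metis
qed

section \<open>From single degrees to the graded groups\<close>

lemma graded_forg_group_hom:
  "group_hom (graded_supp_coh K i R D A) (graded_coh CX D A) (graded_forg K i R D A)"
  unfolding graded_supp_coh_def graded_coh_def graded_forg_def[abs_def]
  by (rule sum_group_map_hom) (use supp_coh_group_is_group coh_group_is_group(1)[OF A] forg_hom in auto)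

lemma ambiguity_group_eq_kernel:
  "ambiguity_group K j R D A =
    kernel (graded_supp_coh K i R D A) (graded_coh CX D A) (graded_forg K i R D A)"
proof -
  let ?S = "graded_supp_coh K i R D A"
  \<comment> \<open>This bijection matches target degrees in D with the source degrees used in
    \<open>ambiguity_group\<close>.\<close>
  have "bij_betw (\<lambda>d. d - 1) D {d. d + 1 \<in> D}"
    by (rule bij_betw_byWitness[where f' = "\<lambda>d. d + 1"]) auto
  then have "ambiguity_group K j R D A = {x \<in> carrier ?S.
      \<forall>d\<in>D. x d \<in> delta K j R A (d - 1) ` carrier (coh_group CU (pull A) (d - 1))}"
    unfolding ambiguity_group_def graded_delta_def[abs_def] graded_coh_def graded_supp_coh_def
    using coh_group_is_group(2)[OF adj.left.obj[OF A]] supp_coh_group_is_group delta_hom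
    by (intro sum_group_map_image) auto
  also have "\<dots> = {x \<in> carrier ?S. \<forall>d\<in>D. forg K i R A d (x d) = \<one>\<^bsub>coh_group CX A d\<^esub>}"
  proof (rule Collect_cong, rule conj_cong[OF refl], rule ball_cong[OF refl])
    fix x d assume "x \<in> carrier ?S" and d: "d \<in> D"
    then have "x d \<in> carrier (supp_coh_group K i R A d)"
      using supp_coh_group_is_group by (auto simp: graded_supp_coh_def carrier_sum_group)
    then show "x d \<in> delta K j R A (d - 1) ` carrier (coh_group CU (pull A) (d - 1)) \<longleftrightarrow>
        forg K i R A d (x d) = \<one>\<^bsub>coh_group CX A d\<^esub>"
      by (simp add: forg_kernel)
  qed
  also have "\<dots> = kernel ?S (graded_coh CX D A) (graded_forg K i R D A)"
    by (auto simp: kernel_def graded_coh_def graded_forg_def fun_eq_iff)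
  finally show ?thesis .
qed

lemma graded_forg_image:
  assumes x: "x \<in> carrier (graded_coh CX D A)" and y: "y \<in> carrier (graded_coh CX D A)"
    and eq: "graded_restr K j D A x = graded_restr K j D A y"
  shows "x \<otimes>\<^bsub>graded_coh CX D A\<^esub> inv\<^bsub>graded_coh CX D A\<^esub> y
    \<in> graded_forg K i R D A ` carrier (graded_supp_coh K i R D A)"
proof -
  let ?H = "graded_coh CX D A"
  note H = coh_group_is_group(1)[OF A]
  have "group ?H"
    using H by (simp add: graded_coh_def)
  then have "x \<otimes>\<^bsub>?H\<^esub> inv\<^bsub>?H\<^esub> y \<in> carrier ?H"
    using x y by (simp add: group.is_monoid monoid.m_closed)
  moreover have "(x \<otimes>\<^bsub>?H\<^esub> inv\<^bsub>?H\<^esub> y) d \<in> forg K i R A d ` carrier (supp_coh_group K i R A d)"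
    if d: "d \<in> D" for d
  proof -
    have "x d \<in> carrier (coh_group CX A d)" "y d \<in> carrier (coh_group CX A d)"
      using x y d H by (auto simp: graded_coh_def carrier_sum_group)
    moreover have "restr K j A d (x d) = restr K j A d (y d)"
      using fun_cong[OF eq, of d] d by (simp add: graded_restr_def)
    moreover have "(x \<otimes>\<^bsub>?H\<^esub> inv\<^bsub>?H\<^esub> y) d = x d \<otimes>\<^bsub>coh_group CX A d\<^esub> inv\<^bsub>coh_group CX A d\<^esub> y d"
      using y d H by (simp add: graded_coh_def)
    ultimately show ?thesis
      using forg_image by simp
  qed
  ultimately show ?thesis
    using sum_group_map_image[of "\<lambda>d. d" D D "supp_coh_group K i R A" "coh_group CX A" "forg K i R A"]
      supp_coh_group_is_group H forg_hom
    unfolding graded_forg_def[abs_def] graded_coh_def graded_supp_coh_def by (simp add: bij_betw_def)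
qed

end

lemma localisation_triangleI:
  assumes "coefficient_system K" "recollement K i j R" "A \<in> Obj (Coef K (Cod (Spaces K) i))"
  shows "localisation_triangle K j i R A"
proof -
  note rec = assms(2)
  have cod: "Cod (Spaces K) j = Cod (Spaces K) i"
    by (rule recollement.complement(1)[OF rec])
  interpret open_immersion_system K j
    using assms(1) recollement.open_immersion[OF rec]
    by (simp add: open_immersion_system_def open_immersion_system_axioms_def)
  have "USCounit R A \<in> Hom CX (supp_obj K i R A) A"
    using recollement.upper_shriek[OF rec] assms(3) cod
    by (simp add: is_adjunction_def is_nat_trans_def comp_func_def id_func_def supp_obj_def)
  then show ?thesis
    using recollement.upper_triangle[OF rec assms(3)] assms(3) cod
    by unfold_locales simp_all
qed

theorem corollary10p10:
  fixes K :: "('s, 'f, 'p, 'o, 'm) coeff_sys"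
    and X :: 's and i j :: 'f
    and R :: "('o, 'm) recoll"
    and A :: 'o
    and D :: "int set"
    and c :: "'m char_classes"
  assumes "coefficient_system K"
    and "is_singular_space (Spaces K) X"
    and "singular_locus_immersion (Spaces K) X i"
    and "regular_locus_immersion (Spaces K) X j"
    and "recollement K i j R"
    and "A \<in> Obj (Coef K X)"
    and "has_values_in c (graded_coh (Coef K X) D A)"
    and "graded_restr K j D A (VirClass c) = graded_restr K j D A (Class c)"
  shows "(ambiguity_group K j R D A = {\<one>\<^bsub>graded_supp_coh K i R D A\<^esub>} \<longrightarrow>
            (\<exists>!m. m \<in> milnor_torsor K i R D A c)) \<and>
         (ambiguity_group K j R D A \<noteq> {\<one>\<^bsub>graded_supp_coh K i R D A\<^esub>} \<longrightarrow>
            (\<exists>m \<in> milnor_torsor K i R D A c. \<exists>m' \<in> milnor_torsor K i R D A c. m \<noteq> m'))"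
proof -
  have X: "Cod (Spaces K) i = X" "Cod (Spaces K) j = X"
    using assms(3,4) by (simp_all add: singular_locus_immersion_def regular_locus_immersion_def)
  interpret localisation_triangle K j i R A
    using localisation_triangleI assms(1,5,6) X by metis
  let ?S = "graded_supp_coh K i R D A" and ?H = "graded_coh (Coef K X) D A"
    and ?f = "graded_forg K i R D A"
  have "milnor_defect ?H c \<in> ?f ` carrier ?S"
    using graded_forg_image assms(7,8) X by (simp add: milnor_defect_def has_values_in_def)
  then obtain m where m: "m \<in> carrier ?S" "milnor_defect ?H c = ?f m"
    by blast
  then have torsor: "x \<in> milnor_torsor K i R D A c \<longleftrightarrow> x \<in> carrier ?S \<and> ?f x = ?f m" for x
    using X by (simp add: milnor_torsor_def)
  have "(\<exists>!x. x \<in> milnor_torsor K i R D A c) \<longleftrightarrow> ambiguity_group K j R D A = {\<one>\<^bsub>?S\<^esub>}"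
    unfolding torsor ambiguity_group_eq_kernel
    by (rule group_hom_fibre_unique_iff[OF graded_forg_group_hom m(1)])
  \<comment> \<open>Failure of uniqueness alone would also allow an empty torsor; with this member
    it yields two distinct elements.\<close>
  moreover have "m \<in> milnor_torsor K i R D A c"
    using torsor m(1) by blast
  ultimately show ?thesis
    by blast
qed

end
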